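(* Let $X=\begin{bmatrix} X_{11} & X_{12} \\ X_{12} & X_{22} \end{bmatrix}$ be a $\mathcal{D}_2$-valued random matrix having a density which is continuously differentiable and strictly positive on $\mathcal{D}_2$. Assume that the three random variables $$X_{11},\qquad X_{2\cdot1}=X_{22}-\frac{X_{12}^2}{X_{11}},\qquad V_1=\frac{X_{12}}{\sqrt{(1-X_{11})(X_{11}-X_{11}X_{22}+X_{12}^2)}}$$ are independent, and that the three random variables $$X_{22},\qquad X_{1\cdot2}=X_{11}-\frac{X_{12}^2}{X_{22}},\qquad V_2=\frac{X_{12}}{\sqrt{(1-X_{22})(X_{22}-X_{11}X_{22}+X_{12}^2)}}$$ are independent. Then there exist constants $a,b,c>0$ such that the density of $X$ is of the form $$f_X\left(x=\begin{bmatrix} x_{11} & x_{12} \\ x_{12} & x_{22} \end{bmatrix}\right)=\frac{(\det x)^{a-1}\,(\det(e-x))^{b-1}\,|x_{12}|^{2c-1}\,I_{\mathcal{D}_2}(x)}{B(a,b)\,B(a+b,c)\,B(a+c,b+c)}.$$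
   Context: $\mathcal{V}_2$ is the space of real symmetric $2\times2$ matrices, $\mathcal{V}_2^+\subset\mathcal{V}_2$ is the cone of positive definite ones, $e=e_2$ is the $2\times2$ identity matrix, and $\mathcal{D}_2=\{x\in\mathcal{V}_2^+:\ e-x\in\mathcal{V}_2^+\}$. Densities are with respect to Lebesgue measure on $\mathcal{V}_2$, identified with $\mathbb{R}^3$ through the coordinates $(x_{11},x_{22},x_{12})$, i.e. $dx_{11}\,dx_{22}\,dx_{12}$. $I_{\mathcal{D}_2}$ is the indicator function of $\mathcal{D}_2$, and $B(\cdot,\cdot)$ is the Euler beta function $B(s,t)=\Gamma(s)\Gamma(t)/\Gamma(s+t)$. *)

theory Defs
  imports "HOL-Probability.Probability"
begin

definition sym_matrices :: "(real ^ 2 ^ 2) set" where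
  "sym_matrices = {x. transpose x = x}"

definition pos_def_matrices :: "(real ^ 2 ^ 2) set" where
  "pos_def_matrices = {x \<in> sym_matrices. \<forall>v. v \<noteq> 0 \<longrightarrow> v \<bullet> (x *v v) > 0}"

definition D2 :: "(real ^ 2 ^ 2) set" where
  "D2 = {x \<in> pos_def_matrices. mat 1 - x \<in> pos_def_matrices}"

text \<open>The coordinates on the symmetric matrices, in the order
  \<open>(x11, x22, x12)\<close>.\<close>

definition sym_of_coords :: "real \<times> real \<times> real \<Rightarrow> real ^ 2 ^ 2" where
  "sym_of_coords = (\<lambda>(x11, x22, x12). vector [vector [x11, x12], vector [x12, x22]])"

lemma sym_of_coords_nth [simp]:
  "sym_of_coords (x11, x22, x12) $ 1 $ 1 = x11"
  "sym_of_coords (x11, x22, x12) $ 1 $ 2 = x12"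
  "sym_of_coords (x11, x22, x12) $ 2 $ 1 = x12"
  "sym_of_coords (x11, x22, x12) $ 2 $ 2 = x22"
  by (simp_all add: sym_of_coords_def)

lemma bounded_linear_sym_of_coords: "bounded_linear sym_of_coords"
  unfolding linear_conv_bounded_linear[symmetric]
  by (rule linearI) (auto simp: vec_eq_iff forall_2)

lemma sym_matrices_iff: "x \<in> sym_matrices \<longleftrightarrow> x $ 2 $ 1 = x $ 1 $ 2"
  unfolding sym_matrices_def transpose_def by (simp only: vec_eq_iff forall_2 mem_Collect_eq vec_lambda_beta) auto

lemma range_sym_of_coords: "range sym_of_coords = sym_matrices"
proof (intro equalityI subsetI)
  fix x assume "x \<in> range sym_of_coords"
  then show "x \<in> sym_matrices"
    by (auto simp: sym_matrices_iff)
next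
  fix x assume "x \<in> sym_matrices"
  then have "x = sym_of_coords (x $ 1 $ 1, x $ 2 $ 2, x $ 1 $ 2)"
    by (simp add: vec_eq_iff forall_2 sym_matrices_iff)
  then show "x \<in> range sym_of_coords" by (rule range_eqI)
qed

text \<open>Lebesgue measure \<open>dx11 dx22 dx12\<close> of the symmetric matrices, as a measure on all
  \<open>2 \<times> 2\<close> matrices that is concentrated on the symmetric ones. It is a pushforward
  because \<^term>\<open>lborel :: (real ^ 2 ^ 2) measure\<close> is four-dimensional.\<close>

definition lborel_sym :: "(real ^ 2 ^ 2) measure" where
  "lborel_sym = distr lborel borel sym_of_coords"

lemma measurable_sym_of_coords [measurable]: "sym_of_coords \<in> borel_measurable borel"
  using bounded_linear_sym_of_coords
  by (intro borel_measurable_continuous_onI) (rule linear_continuous_on)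

lemma space_lborel_sym [simp]: "space lborel_sym = UNIV"
  and sets_lborel_sym [simp, measurable_cong]: "sets lborel_sym = sets borel"
  by (simp_all add: lborel_sym_def)

definition continuously_differentiable_on ::
    "('a::real_normed_vector \<Rightarrow> 'b::real_normed_vector) \<Rightarrow> 'a set \<Rightarrow> bool" where
  "continuously_differentiable_on g S \<longleftrightarrow>
     (\<exists>g'. (\<forall>p\<in>S. (g has_derivative blinfun_apply (g' p)) (at p)) \<and> continuous_on S g')"

text \<open>The library sets \<open>0 powr 0 = 0\<close>; the density needs \<open>0\<^sup>0 = 1\<close>, which is
  \<open>\<bar>x12\<bar>\<close> raised to \<open>2 * c - 1\<close> at \<open>x12 = 0\<close> for \<open>c = 1 / 2\<close>.\<close>

definition rpow :: "real \<Rightarrow> real \<Rightarrow> real" where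
  "rpow t s = (if s = 0 then 1 else t powr s)"

definition D2_density :: "real \<Rightarrow> real \<Rightarrow> real \<Rightarrow> real ^ 2 ^ 2 \<Rightarrow> real" where
  "D2_density a b c x =
     rpow (det x) (a - 1) * rpow (det (mat 1 - x)) (b - 1) * rpow \<bar>x $ 1 $ 2\<bar> (2 * c - 1)
       * indicator D2 x
     / (Beta a b * Beta (a + b) c * Beta (a + c) (b + c))"

end

theory Submission
  imports Defs
begin

text \<open>
  The map \<open>chart\<close> inverts \<open>x \<mapsto> (X11, X2.1, V1)\<close>. It is a shift in \<open>x22\<close> followed by a scaling
  in \<open>x12\<close>, it sends the open box \<open>(0,1) \<times> (0,1) \<times> (-1,1)\<close> onto \<open>D2\<close>, and under it
  \<open>det x = u w\<close> and \<open>det (e - x) = (1 - u) (1 - w) (1 - v\<^sup>2)\<close>. Comparing the probabilities of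
  small cubes turns each independence assumption into an additive splitting of \<open>ln f\<close> in these
  coordinates.

  Equating the two splittings and eliminating \<open>x12\<close> gives
  \<open>a x + b (y - t / x) + \<Phi> (m / x) = b y + a (x - t / y) + \<Psi> (m / y)\<close>. Its first-order behaviour
  as \<open>m\<close> tends to \<open>0\<close> determines \<open>x a' x\<close> and \<open>y b' y\<close>; although \<open>\<Phi>\<close> is not known to be
  differentiable at \<open>0\<close>, the limits of \<open>(\<Phi> (r s) - \<Phi> s) / s\<close> exist and form a cocycle, hence are
  linear in \<open>r\<close>. So \<open>a\<close> and \<open>b\<close> are combinations of \<open>ln x\<close> and \<open>ln (1 - x)\<close>, and then \<open>\<Phi>\<close> is
  found by sending the argument of \<open>\<Psi>\<close> to \<open>0\<close>.

  Since \<open>f\<close> is continuous and positive where \<open>x12 = 0\<close>, only \<open>c = 1/2\<close> can occur.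
\<close>

section \<open>Coordinates on \<open>D2\<close>\<close>

text \<open>Sylvester's criterion for \<open>x\<close> and \<open>e - x\<close> at once: the
  diagonal entries and the determinants of both are positive.\<close>

definition D2_coords :: "(real \<times> real \<times> real) set" where
  "D2_coords = {(x, y, z). 0 < x \<and> x < 1 \<and> 0 < y \<and> y < 1 \<and> z\<^sup>2 < x * y \<and> z\<^sup>2 < (1 - x) * (1 - y)}"

definition chart :: "real \<times> real \<times> real \<Rightarrow> real \<times> real \<times> real" where
  "chart = (\<lambda>(u, w, v). (u, w + v\<^sup>2 * (1 - u) * (1 - w), v * sqrt (u * (1 - u) * (1 - w))))"

text \<open>The Jacobian determinant of \<open>chart\<close>: the scaling in \<open>x12\<close>
  contributes the square root, the shift in \<open>x22\<close> contributes 1. It does not depend on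
  \<open>v\<close>.\<close>

definition chart_jacobian :: "real \<times> real \<times> real \<Rightarrow> real" where
  "chart_jacobian = (\<lambda>(u, w, v). sqrt (u * (1 - u) * (1 - w)))"

definition chart_box :: "(real \<times> real \<times> real) set" where
  "chart_box = {0<..<1} \<times> {0<..<1} \<times> {-1<..<1}"

lemma pos_def_sym_of_coords_iff:
  "sym_of_coords (x, y, z) \<in> pos_def_matrices \<longleftrightarrow> 0 < x \<and> 0 < y \<and> z\<^sup>2 < x * y"
proof -
  have form: "v \<bullet> (sym_of_coords (x, y, z) *v v)
      = x * (v $ 1)\<^sup>2 + 2 * z * (v $ 1) * (v $ 2) + y * (v $ 2)\<^sup>2" for v :: "real ^ 2"
    by (simp add: inner_vec_def matrix_vector_mult_def sum_2 power2_eq_square algebra_simps)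
  have sym: "sym_of_coords (x, y, z) \<in> sym_matrices"
    by (simp add: sym_matrices_iff)
  show ?thesis
  proof
    assume "sym_of_coords (x, y, z) \<in> pos_def_matrices"
    then have pos: "x * p\<^sup>2 + 2 * z * p * q + y * q\<^sup>2 > 0" if "p \<noteq> 0 \<or> q \<noteq> 0" for p q
    proof -
      have "vector [p, q] \<noteq> (0 :: real ^ 2)"
        using that by (auto simp: vec_eq_iff forall_2)
      then show ?thesis
        using form[of "vector [p, q]"] \<open>sym_of_coords (x, y, z) \<in> pos_def_matrices\<close>
        by (auto simp: pos_def_matrices_def)
    qed
    have x: "x > 0" using pos[of 1 0] by simp
    moreover have "y > 0" using pos[of 0 1] by simp
    \<comment> \<open>At the vector \<open>(- z, x)\<close> the completed square vanishes, and what
      is left of the form is \<open>x\<close> times the determinant.\<close>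
    moreover have "x * (x * y - z\<^sup>2) > 0"
      using pos[of "- z" x] x by (simp add: power2_eq_square algebra_simps)
    ultimately show "0 < x \<and> 0 < y \<and> z\<^sup>2 < x * y"
      by (simp add: zero_less_mult_iff)
  next
    assume A: "0 < x \<and> 0 < y \<and> z\<^sup>2 < x * y"
    have "x * p\<^sup>2 + 2 * z * p * q + y * q\<^sup>2 > 0" if "p \<noteq> 0 \<or> q \<noteq> 0" for p q
    proof -
      have "x * (x * p\<^sup>2 + 2 * z * p * q + y * q\<^sup>2) = (x * p + z * q)\<^sup>2 + (x * y - z\<^sup>2) * q\<^sup>2"
        by (simp add: power2_eq_square algebra_simps)
      also have "\<dots> > 0"
        using A that by (cases "q = 0") (auto intro: add_nonneg_pos)
      finally show ?thesis using A by (simp add: zero_less_mult_iff)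
    qed
    moreover have "v $ 1 \<noteq> 0 \<or> v $ 2 \<noteq> 0" if "v \<noteq> 0" for v :: "real ^ 2"
      using that by (auto simp: vec_eq_iff forall_2)
    ultimately show "sym_of_coords (x, y, z) \<in> pos_def_matrices"
      using sym form by (simp add: pos_def_matrices_def)
  qed
qed

lemma one_minus_sym_of_coords:
  "mat 1 - sym_of_coords (x, y, z) = sym_of_coords (1 - x, 1 - y, - z)"
  by (simp add: vec_eq_iff forall_2 mat_def)

lemma sym_of_coords_in_D2_iff: "sym_of_coords p \<in> D2 \<longleftrightarrow> p \<in> D2_coords"
  by (cases p) (auto simp: D2_def D2_coords_def one_minus_sym_of_coords pos_def_sym_of_coords_iff)

lemma D2E:
  assumes "x \<in> D2"
  obtains p where "p \<in> D2_coords" "x = sym_of_coords p"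
proof -
  have "x \<in> range sym_of_coords"
    using assms by (auto simp: D2_def pos_def_matrices_def range_sym_of_coords)
  then show ?thesis using assms that sym_of_coords_in_D2_iff by auto
qed

lemma open_D2_coords: "open D2_coords"
  unfolding D2_coords_def case_prod_beta
  by (intro open_Collect_conj open_Collect_less continuous_intros)

lemma measurable_D2_coords [measurable]: "D2_coords \<in> sets borel"
  using open_D2_coords by simp

lemma open_chart_box: "open chart_box"
  by (simp add: chart_box_def open_Times)

lemma measurable_chart_box [measurable]: "chart_box \<in> sets borel"
  using open_chart_box by simp

lemma continuous_on_chart: "continuous_on UNIV chart"
  unfolding chart_def case_prod_beta by (intro continuous_intros)

lemma continuous_on_chart_jacobian: "continuous_on UNIV chart_jacobian"
  unfolding chart_jacobian_def case_prod_beta by (intro continuous_intros)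

lemma measurable_chart [measurable]: "chart \<in> borel_measurable borel"
  using continuous_on_chart by (rule borel_measurable_continuous_onI)

lemma measurable_chart_jacobian [measurable]: "chart_jacobian \<in> borel_measurable borel"
  using continuous_on_chart_jacobian by (rule borel_measurable_continuous_onI)

text \<open>The determinant of \<open>x\<close> is \<open>u * w\<close>, which is positive anyway.
  Only the determinant of \<open>e - x\<close>, equal to
  \<open>(1 - u) * (1 - w) * (1 - v\<^sup>2)\<close>, restricts \<open>v\<close>, and its positivity
  also forces \<open>y < 1\<close>.\<close>

lemma chart_in_D2_coords_iff:
  assumes u: "0 < u" "u < 1" and w: "0 < w" "w < 1"
  shows "chart (u, w, v) \<in> D2_coords \<longleftrightarrow> -1 < v \<and> v < 1"
proof -
  define y where "y = w + v\<^sup>2 * (1 - u) * (1 - w)"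
  define s where "s = u * (1 - u) * (1 - w)"
  have s: "s > 0" using u w by (simp add: s_def)
  have z2: "(v * sqrt s)\<^sup>2 = v\<^sup>2 * s" using s by (simp add: power_mult_distrib)
  have uy: "u * y = u * w + v\<^sup>2 * s" by (simp add: y_def s_def algebra_simps)
  have D: "(1 - u) * (1 - y) - v\<^sup>2 * s = (1 - u) * (1 - w) * (1 - v\<^sup>2)"
    by (simp add: y_def s_def power2_eq_square algebra_simps)
  have y0: "y > 0" unfolding y_def using u w by (intro add_pos_nonneg mult_nonneg_nonneg) auto
  have c1: "v\<^sup>2 * s < (1 - u) * (1 - y) \<longleftrightarrow> v\<^sup>2 < 1"
  proof -
    have "v\<^sup>2 * s < (1 - u) * (1 - y) \<longleftrightarrow> 0 < (1 - u) * (1 - w) * (1 - v\<^sup>2)"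
      using D by linarith
    also have "\<dots> \<longleftrightarrow> v\<^sup>2 < 1"
      using mult_less_cancel_left_pos[of "(1 - u) * (1 - w)" 0 "1 - v\<^sup>2"] u w by simp
    finally show ?thesis .
  qed
  have y1: "y < 1" if "v\<^sup>2 < 1"
  proof -
    have "v\<^sup>2 * s \<ge> 0" using s by simp
    then have "0 < (1 - u) * (1 - y)" using c1 that by linarith
    then show ?thesis using u by (simp add: zero_less_mult_iff)
  qed
  have "chart (u, w, v) \<in> D2_coords \<longleftrightarrow> v\<^sup>2 < 1"
    using u w c1 y0 y1 uy s z2
    by (auto simp: D2_coords_def chart_def y_def[symmetric] s_def[symmetric])
  also have "\<dots> \<longleftrightarrow> -1 < v \<and> v < 1"
    by (auto simp: abs_square_less_1 abs_less_iff)
  finally show ?thesis .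
qed

lemma chart_in_D2_coords: "q \<in> chart_box \<Longrightarrow> chart q \<in> D2_coords"
  using chart_in_D2_coords_iff by (cases q) (auto simp: chart_box_def)

text \<open>The Schur complement is \<open>det x / x11\<close>, hence positive, and it is at most
  \<open>x22\<close>.\<close>

lemma D2_coords_schur:
  assumes "(x, y, z) \<in> D2_coords"
  shows "0 < y - z\<^sup>2 / x" "y - z\<^sup>2 / x < 1"
proof -
  have *: "0 < x" "x < 1" "0 < y" "y < 1" "z\<^sup>2 < x * y"
    using assms by (auto simp: D2_coords_def)
  then show "0 < y - z\<^sup>2 / x" by (simp add: field_simps)
  have "z\<^sup>2 / x \<ge> 0" using * by simp
  then show "y - z\<^sup>2 / x < 1" using * by linarith
qed

section \<open>Change of variables along the chart\<close>

lemma nn_integral_lborel_prod3: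
  fixes K :: "real \<times> real \<times> real \<Rightarrow> ennreal"
  assumes [measurable]: "K \<in> borel_measurable borel"
  shows "(\<integral>\<^sup>+p. K p \<partial>lborel) = (\<integral>\<^sup>+x. \<integral>\<^sup>+y. \<integral>\<^sup>+z. K (x, y, z) \<partial>lborel \<partial>lborel \<partial>lborel)"
proof -
  have [measurable]: "K \<in> borel_measurable (lborel \<Otimes>\<^sub>M (lborel \<Otimes>\<^sub>M lborel))"
    by (simp add: lborel_prod)
  have "(\<integral>\<^sup>+p. K p \<partial>lborel) = (\<integral>\<^sup>+p. K p \<partial>(lborel \<Otimes>\<^sub>M (lborel \<Otimes>\<^sub>M lborel)))"
    by (simp add: lborel_prod)
  also have "\<dots> = (\<integral>\<^sup>+x. \<integral>\<^sup>+q. K (x, q) \<partial>(lborel \<Otimes>\<^sub>M lborel) \<partial>lborel)"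
    by (subst sigma_finite_measure.nn_integral_fst[symmetric])
       (auto simp: lborel_prod lborel.sigma_finite_measure_axioms)
  also have "\<dots> = (\<integral>\<^sup>+x. \<integral>\<^sup>+y. \<integral>\<^sup>+z. K (x, y, z) \<partial>lborel \<partial>lborel \<partial>lborel)"
    by (intro nn_integral_cong, subst lborel.nn_integral_fst[symmetric])
       (auto simp: measurable_compose)
  finally show ?thesis .
qed

text \<open>Fubini reduces the substitution to two affine ones on the line: a shift of
  \<open>x22\<close> by \<open>z\<^sup>2 / x\<close> for fixed \<open>x\<close> and
  \<open>z\<close>, then a scaling of \<open>z\<close> for fixed \<open>x\<close> and
  \<open>w\<close>.\<close>

lemma nn_integral_chart:
  fixes H :: "real \<times> real \<times> real \<Rightarrow> ennreal"
  assumes [measurable]: "H \<in> borel_measurable borel"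
  shows "(\<integral>\<^sup>+p. H p * indicator D2_coords p \<partial>lborel)
    = (\<integral>\<^sup>+q. H (chart q) * ennreal (chart_jacobian q) * indicator chart_box q \<partial>lborel)"
proof -
  let ?K = "\<lambda>p. H p * indicator D2_coords p"
  let ?J = "\<lambda>q. H (chart q) * ennreal (chart_jacobian q) * indicator chart_box q"
  have [measurable]: "H \<in> borel_measurable (borel \<Otimes>\<^sub>M (borel \<Otimes>\<^sub>M borel))"
    unfolding borel_prod by (rule assms)
  have [measurable]: "D2_coords \<in> sets (borel \<Otimes>\<^sub>M (borel \<Otimes>\<^sub>M borel))"
    unfolding borel_prod by (rule measurable_D2_coords)
  have inner: "(\<integral>\<^sup>+z. ?K (x, w + z\<^sup>2 / x, z) \<partial>lborel) = (\<integral>\<^sup>+v. ?J (x, w, v) \<partial>lborel)" for x w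
  proof (cases "0 < x \<and> x < 1 \<and> 0 < w \<and> w < 1")
    case True
    define s where "s = sqrt (x * (1 - x) * (1 - w))"
    have s: "s > 0" using True by (simp add: s_def)
    have ch: "(x, w + (s * v)\<^sup>2 / x, s * v) = chart (x, w, v)" for v
      using True by (simp add: chart_def s_def power_mult_distrib)
    have "(\<integral>\<^sup>+z. ?K (x, w + z\<^sup>2 / x, z) \<partial>lborel)
        = ennreal \<bar>s\<bar> * (\<integral>\<^sup>+v. ?K (x, w + (0 + s * v)\<^sup>2 / x, 0 + s * v) \<partial>lborel)"
      using s by (intro nn_integral_real_affine) auto
    also have "\<dots> = (\<integral>\<^sup>+v. ennreal s * ?K (chart (x, w, v)) \<partial>lborel)"
      using s by (subst nn_integral_cmult[symmetric]) (auto simp: ch)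
    also have "\<dots> = (\<integral>\<^sup>+v. ?J (x, w, v) \<partial>lborel)"
    proof (intro nn_integral_cong)
      fix v
      have "chart_jacobian (x, w, v) = s" by (simp add: chart_jacobian_def s_def)
      moreover have "indicator D2_coords (chart (x, w, v)) = (indicator chart_box (x, w, v) :: ennreal)"
        using True chart_in_D2_coords_iff[of x w v] by (simp add: indicator_def chart_box_def)
      ultimately show "ennreal s * ?K (chart (x, w, v)) = ?J (x, w, v)"
        by (simp only: mult_ac)
    qed
    finally show ?thesis .
  next
    case False
    \<comment> \<open>Here both integrands vanish identically: a point of \<open>D2_coords\<close>
      has its first coordinate and its Schur complement \<open>w\<close> in the unit
      interval.\<close>
    have "?K (x, w + z\<^sup>2 / x, z) = 0" for z
      using False D2_coords_schur[of x "w + z\<^sup>2 / x" z]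
      by (auto simp: indicator_def D2_coords_def)
    moreover have "?J (x, w, v) = 0" for v
      using False by (auto simp: indicator_def chart_box_def)
    ultimately show ?thesis by (simp only:)
  qed
  have "(\<integral>\<^sup>+p. ?K p \<partial>lborel) = (\<integral>\<^sup>+x. \<integral>\<^sup>+y. \<integral>\<^sup>+z. ?K (x, y, z) \<partial>lborel \<partial>lborel \<partial>lborel)"
    by (rule nn_integral_lborel_prod3) measurable
  \<comment> \<open>The size of the shift depends on \<open>z\<close>, so the integral over
    \<open>y\<close> must be innermost; the order is reversed again before the scaling.\<close>
  also have "\<dots> = (\<integral>\<^sup>+x. \<integral>\<^sup>+z. \<integral>\<^sup>+y. ?K (x, y, z) \<partial>lborel \<partial>lborel \<partial>lborel)"
  proof (rule nn_integral_cong)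
    fix x :: real
    show "(\<integral>\<^sup>+y. \<integral>\<^sup>+z. ?K (x, y, z) \<partial>lborel \<partial>lborel) = (\<integral>\<^sup>+z. \<integral>\<^sup>+y. ?K (x, y, z) \<partial>lborel \<partial>lborel)"
      by (rule lborel_pair.Fubini') measurable
  qed
  also have "\<dots> = (\<integral>\<^sup>+x. \<integral>\<^sup>+z. \<integral>\<^sup>+w. ?K (x, w + z\<^sup>2 / x, z) \<partial>lborel \<partial>lborel \<partial>lborel)"
  proof (rule nn_integral_cong, rule nn_integral_cong)
    fix x z :: real
    show "(\<integral>\<^sup>+y. ?K (x, y, z) \<partial>lborel) = (\<integral>\<^sup>+w. ?K (x, w + z\<^sup>2 / x, z) \<partial>lborel)"
      using nn_integral_real_affine[of "\<lambda>y. ?K (x, y, z)" 1 "z\<^sup>2 / x"]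
      by (simp add: add.commute)
  qed
  also have "\<dots> = (\<integral>\<^sup>+x. \<integral>\<^sup>+w. \<integral>\<^sup>+z. ?K (x, w + z\<^sup>2 / x, z) \<partial>lborel \<partial>lborel \<partial>lborel)"
  proof (rule nn_integral_cong)
    fix x :: real
    show "(\<integral>\<^sup>+z. \<integral>\<^sup>+w. ?K (x, w + z\<^sup>2 / x, z) \<partial>lborel \<partial>lborel)
        = (\<integral>\<^sup>+w. \<integral>\<^sup>+z. ?K (x, w + z\<^sup>2 / x, z) \<partial>lborel \<partial>lborel)"
      by (rule lborel_pair.Fubini') measurable
  qed
  also have "\<dots> = (\<integral>\<^sup>+x. \<integral>\<^sup>+w. \<integral>\<^sup>+v. ?J (x, w, v) \<partial>lborel \<partial>lborel \<partial>lborel)"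
    by (simp only: inner)
  also have "\<dots> = (\<integral>\<^sup>+q. ?J q \<partial>lborel)"
    by (rule nn_integral_lborel_prod3[symmetric]) measurable
  finally show ?thesis .
qed

text \<open>The triple \<open>(X11, X2.1, V1)\<close> as a function of
  \<open>(x11, x22, x12)\<close>. Exchanging \<open>x11\<close> and \<open>x22\<close> in the
  argument gives the other triple, \<open>(X22, X1.2, V2)\<close>.\<close>

definition chart_inv :: "real \<times> real \<times> real \<Rightarrow> real \<times> real \<times> real" where
  "chart_inv = (\<lambda>(x, y, z). (x, y - z\<^sup>2 / x, z / sqrt ((1 - x) * (x - x * y + z\<^sup>2))))"

lemma chart_inv_chart:
  assumes "q \<in> chart_box" shows "chart_inv (chart q) = q"
proof -
  obtain u w v where q: "q = (u, w, v)" by (cases q)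
  have b: "0 < u" "u < 1" "0 < w" "w < 1" using assms by (auto simp: q chart_box_def)
  define s where "s = u * (1 - u) * (1 - w)"
  have s: "s > 0" using b by (simp add: s_def)
  have z2: "(v * sqrt s)\<^sup>2 = v\<^sup>2 * s" using s by (simp add: power_mult_distrib)
  have "v\<^sup>2 * s / u = v\<^sup>2 * (1 - u) * (1 - w)" using b by (simp add: s_def)
  moreover have "(1 - u) * (u - u * (w + v\<^sup>2 * (1 - u) * (1 - w)) + v\<^sup>2 * s) = s"
    by (simp add: s_def algebra_simps)
  ultimately show ?thesis
    using s by (simp add: q chart_def chart_inv_def z2 s_def[symmetric])
qed

lemma chart_inv_in_chart_box:
  assumes "p \<in> D2_coords" shows "chart_inv p \<in> chart_box" and "chart (chart_inv p) = p"
proof -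
  obtain x y z where p: "p = (x, y, z)" by (cases p)
  have x: "0 < x" "x < 1" using assms by (auto simp: p D2_coords_def)
  define w where "w = y - z\<^sup>2 / x"
  have w: "0 < w" "w < 1" using D2_coords_schur assms by (auto simp: p w_def)
  define s where "s = x * (1 - x) * (1 - w)"
  have s: "s > 0" using x w by (simp add: s_def)
  \<comment> \<open>The radicand in \<open>V1\<close> is the square of the scaling factor of
    \<open>chart\<close>, so dividing \<open>z\<close> by its root undoes the scaling.\<close>
  have s': "(1 - x) * (x - x * y + z\<^sup>2) = s" 
  proof -
    have "x - x * y + z\<^sup>2 = x * (1 - w)" using x by (simp add: w_def right_diff_distrib distrib_left)
    then show ?thesis by (simp add: s_def)
  qed
  define v where "v = z / sqrt s"
  have z: "z = v * sqrt s" using s by (simp add: v_def)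
  have inv: "chart_inv p = (x, w, v)" by (simp add: p chart_inv_def w_def v_def s')
  have "v\<^sup>2 * (1 - x) * (1 - w) = z\<^sup>2 / x"
    using s x w by (simp add: v_def power_divide s_def)
  then have "w + v\<^sup>2 * (1 - x) * (1 - w) = y" by (simp add: w_def)
  moreover have "v * sqrt (x * (1 - x) * (1 - w)) = z" using z by (simp add: s_def)
  ultimately show ch: "chart (chart_inv p) = p"
    unfolding inv chart_def by (simp add: p)
  show "chart_inv p \<in> chart_box"
    using chart_in_D2_coords_iff[of x w v] x w assms ch by (simp add: inv chart_box_def)
qed

lemma measurable_chart_inv [measurable]: "chart_inv \<in> borel_measurable borel"
proof -
  have "(\<lambda>p. (fst p, fst (snd p) - (snd (snd p))\<^sup>2 / fst p,
      snd (snd p) / sqrt ((1 - fst p) * (fst p - fst p * fst (snd p) + (snd (snd p))\<^sup>2))))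
    \<in> borel_measurable (borel \<Otimes>\<^sub>M (borel \<Otimes>\<^sub>M (borel :: real measure)))"
    unfolding borel_prod[symmetric] by measurable
  then show ?thesis by (simp add: borel_prod chart_inv_def case_prod_beta)
qed

lemma chart_jacobian_pos: "q \<in> chart_box \<Longrightarrow> chart_jacobian q > 0"
  by (auto simp: chart_box_def chart_jacobian_def)

section \<open>Independence as a splitting of the log density\<close>

text \<open>On small sets \<open>S d\<close> continuity at \<open>p\<close> traps \<open>g\<close>
  between \<open>g p - e / 2\<close> and \<open>g p + e / 2\<close>, hence also its average.\<close>

lemma tendsto_average_of_isCont:
  fixes g :: "'a::euclidean_space \<Rightarrow> real" and S :: "'b \<Rightarrow> 'a set"
  assumes cont: "isCont g p"
    and g: "\<And>q. g q \<ge> 0"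
    and shrink: "\<And>e. e > 0 \<Longrightarrow> \<forall>\<^sub>F d in F. S d \<subseteq> ball p e"
    and S: "\<And>d. S d \<in> sets borel"
    and pos: "\<forall>\<^sub>F d in F. emeasure lborel (S d) = ennreal (m d) \<and> m d > 0"
  shows "((\<lambda>d. enn2real (\<integral>\<^sup>+q. ennreal (g q) * indicator (S d) q \<partial>lborel) / m d) \<longlongrightarrow> g p) F"
proof (rule tendstoI)
  fix e :: real assume "e > 0"
  then have "e / 2 > 0" by simp
  from cont[unfolded continuous_at_eps_delta, rule_format, OF this]
  obtain r where r: "r > 0" "\<And>q. dist q p < r \<Longrightarrow> \<bar>g q - g p\<bar> < e / 2"
    by (auto simp: dist_real_def)
  from shrink[OF r(1)] pos
  show "\<forall>\<^sub>F d in F. dist (enn2real (\<integral>\<^sup>+q. ennreal (g q) * indicator (S d) q \<partial>lborel) / m d) (g p) < e"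
  proof eventually_elim
    case (elim d)
    let ?I = "\<integral>\<^sup>+q. ennreal (g q) * indicator (S d) q \<partial>lborel"
    have close: "g q \<le> g p + e / 2" "g p - e / 2 \<le> g q" if "q \<in> S d" for q
    proof -
      have "dist q p < r" using that elim(1) by (auto simp: dist_commute subset_eq)
      from r(2)[OF this] show "g q \<le> g p + e / 2" "g p - e / 2 \<le> g q" by linarith+
    qed
    have "?I \<le> (\<integral>\<^sup>+q. ennreal (g p + e / 2) * indicator (S d) q \<partial>lborel)"
    proof (intro nn_integral_mono)
      show "ennreal (g q) * indicator (S d) q \<le> ennreal (g p + e / 2) * indicator (S d) q" for q
        by (cases "q \<in> S d") (simp_all add: close(1) ennreal_leI)
    qed
    also have "\<dots> = ennreal ((g p + e / 2) * m d)"
      using S elim(2) g[of p] \<open>e > 0\<close> by (simp add: nn_integral_cmult_indicator ennreal_mult)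
    finally have up: "?I \<le> ennreal ((g p + e / 2) * m d)" .
    \<comment> \<open>If \<open>g p - e / 2\<close> is negative, \<open>ennreal\<close> truncates it
      to 0 and the lower bound still holds.\<close>
    have "ennreal ((g p - e / 2) * m d) \<le> (\<integral>\<^sup>+q. ennreal (g p - e / 2) * indicator (S d) q \<partial>lborel)"
      using S elim(2) by (simp add: nn_integral_cmult_indicator ennreal_mult'')
    also have "\<dots> \<le> ?I"
    proof (intro nn_integral_mono)
      show "ennreal (g p - e / 2) * indicator (S d) q \<le> ennreal (g q) * indicator (S d) q" for q
        by (cases "q \<in> S d") (simp_all add: close(2) ennreal_leI)
    qed
    finally have low: "ennreal ((g p - e / 2) * m d) \<le> ?I" .
    have fin: "?I < \<top>" using up le_less_trans ennreal_less_top by blast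
    have "enn2real ?I \<le> (g p + e / 2) * m d"
      using up g[of p] \<open>e > 0\<close> elim(2) by (intro enn2real_leI) auto
    moreover have "(g p - e / 2) * m d \<le> enn2real ?I"
      using low fin by (subst ennreal_le_iff[symmetric]) (simp_all add: top.not_eq_extremum)
    ultimately have "g p - e / 2 \<le> enn2real ?I / m d" "enn2real ?I / m d \<le> g p + e / 2"
      using elim(2) by (simp_all add: field_simps)
    then show ?case using \<open>e > 0\<close> by (simp add: dist_real_def abs_less_iff)
  qed
qed

lemma emeasure_lborel_cube:
  fixes u w v d :: real
  assumes "d > 0"
  shows "emeasure lborel ({u - d<..<u + d} \<times> {w - d<..<w + d} \<times> {v - d<..<v + d}) = ennreal (8 * d ^ 3)"
proof -
  have I: "emeasure lborel {x - d<..<x + d} = ennreal (2 * d)" for x using assms by simp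
  have "emeasure (lborel \<Otimes>\<^sub>M lborel) ({w - d<..<w + d} \<times> {v - d<..<v + d}) = ennreal (2 * d) * ennreal (2 * d)"
    by (subst lborel.emeasure_pair_measure_Times) (simp_all only: I, simp_all)
  then have "emeasure (lborel \<Otimes>\<^sub>M lborel) ({u - d<..<u + d} \<times> {w - d<..<w + d} \<times> {v - d<..<v + d})
      = ennreal (2 * d) * (ennreal (2 * d) * ennreal (2 * d))"
    by (subst lborel.emeasure_pair_measure_Times) (simp_all only: I lborel_prod, simp_all add: open_Times)
  also have "\<dots> = ennreal (8 * d ^ 3)"
    using assms by (simp add: ennreal_mult[symmetric] power3_eq_cube)
  finally show ?thesis by (simp add: lborel_prod)
qed

lemma cube_subset_ball:
  fixes u w v :: real
  assumes "e > 0"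
  shows "\<forall>\<^sub>F d in at_right 0.
    {u - d<..<u + d} \<times> {w - d<..<w + d} \<times> {v - d<..<v + d} \<subseteq> ball (u, w, v) e"
proof -
  have "{u - d<..<u + d} \<times> {w - d<..<w + d} \<times> {v - d<..<v + d} \<subseteq> ball (u, w, v) e"
    if "0 < d" "d < e / 3" for d
  proof (clarsimp simp del: mem_ball, unfold mem_ball)
    fix u' w' v' assume "u - d < u'" "u' < u + d" "w - d < w'" "w' < w + d" "v - d < v'" "v' < v + d"
    then have "dist u u' < d" "dist w w' < d" "dist v v' < d"
      by (auto simp: dist_real_def)
    moreover have "dist (w, v) (w', v') \<le> dist w w' + dist v v'"
      by (simp add: dist_Pair_Pair sqrt_sum_squares_le_sum)
    moreover have "dist (u, w, v) (u', w', v') \<le> dist u u' + dist (w, v) (w', v')"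
      by (subst dist_Pair_Pair) (intro sqrt_sum_squares_le_sum zero_le_dist)
    ultimately show "dist (u, w, v) (u', w', v') < e" using that by linarith
  qed
  then show ?thesis
    unfolding eventually_at_right_field
    using assms by (intro exI[of _ "e / 3"] conjI allI impI) simp_all
qed

text \<open>The marginals enter only through probabilities of intervals, so no regularity of
  marginal densities is needed: products of cube probabilities are compared at each radius
  \<open>d\<close>, and the limit is taken in the joint density, which is continuous on
  \<open>chart_box\<close>.\<close>

lemma chart_factorization:
  fixes M :: "'w measure" and X Y Z :: "'w \<Rightarrow> real" and F :: "real \<times> real \<times> real \<Rightarrow> real"
  assumes "prob_space M"
    and dist: "distributed M lborel (\<lambda>\<omega>. (X \<omega>, Y \<omega>, Z \<omega>)) (\<lambda>p. ennreal (F p))"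
    and in_D: "\<And>\<omega>. \<omega> \<in> space M \<Longrightarrow> (X \<omega>, Y \<omega>, Z \<omega>) \<in> D2_coords"
    and nonneg: "\<And>p. F p \<ge> 0"
    and pos: "\<And>p. p \<in> D2_coords \<Longrightarrow> F p > 0"
    and cont: "\<And>p. p \<in> D2_coords \<Longrightarrow> isCont F p"
    and indep: "prob_space.indep_vars M (\<lambda>_. borel)
      (\<lambda>i \<omega>. [X \<omega>, Y \<omega> - (Z \<omega>)\<^sup>2 / X \<omega>,
        Z \<omega> / sqrt ((1 - X \<omega>) * (X \<omega> - X \<omega> * Y \<omega> + (Z \<omega>)\<^sup>2))] ! i) {0, 1, 2 :: nat}"
  obtains a b c :: "real \<Rightarrow> real" where "c 0 = 0" "(c \<longlongrightarrow> 0) (at 0)"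
    and "\<And>u w v. (u, w, v) \<in> chart_box \<Longrightarrow> ln (F (chart (u, w, v))) = a u + b w + c v"
proof -
  interpret prob_space M by fact
  \<comment> \<open>\<open>g\<close> is the joint density of the independent triple, as
    \<open>T_meas\<close> confirms.\<close>
  define g where "g q = F (chart q) * chart_jacobian q * indicator chart_box q" for q
  define T where "T \<omega> = chart_inv (X \<omega>, Y \<omega>, Z \<omega>)" for \<omega>
  define R where "R i \<omega> = [X \<omega>, Y \<omega> - (Z \<omega>)\<^sup>2 / X \<omega>,
        Z \<omega> / sqrt ((1 - X \<omega>) * (X \<omega> - X \<omega> * Y \<omega> + (Z \<omega>)\<^sup>2))] ! i" for i \<omega>
  have F_meas: "(\<lambda>p. ennreal (F p)) \<in> borel_measurable borel"
    using distributed_borel_measurable[OF dist] by simp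
  have T_R: "T \<omega> = (R 0 \<omega>, R 1 \<omega>, R 2 \<omega>)" for \<omega>
    by (simp add: T_def R_def chart_inv_def)
  have g_pos: "g q > 0" if "q \<in> chart_box" for q
    using pos[OF chart_in_D2_coords[OF that]] chart_jacobian_pos[OF that] that by (simp add: g_def)
  have g_nonneg: "g q \<ge> 0" for q
    using g_pos[of q] by (cases "q \<in> chart_box") (auto simp: g_def)
  have g_cont: "isCont g q" if q: "q \<in> chart_box" for q
  proof -
    have "isCont (\<lambda>q. F (chart q) * chart_jacobian q) q"
      using continuous_on_chart continuous_on_chart_jacobian cont[OF chart_in_D2_coords[OF q]]
      by (intro continuous_intros isCont_o2[of q chart F]) (simp_all add: continuous_on_eq_continuous_at del: split_paired_All)
    moreover have "\<forall>\<^sub>F q' in nhds q. g q' = F (chart q') * chart_jacobian q'"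
      using eventually_nhds_in_open[OF open_chart_box q] by eventually_elim (simp add: g_def)
    ultimately show ?thesis by (simp add: isCont_cong)
  qed
  have T_meas: "emeasure M (T -` S \<inter> space M) = (\<integral>\<^sup>+q. ennreal (g q) * indicator S q \<partial>lborel)"
    if [measurable]: "S \<in> sets borel" for S
  proof -
    let ?A = "chart_inv -` S \<inter> D2_coords"
    have A: "?A \<in> sets borel"
      using measurable_sets[OF measurable_chart_inv, of S] by auto
    have [measurable]: "(\<lambda>p. ennreal (F p) * indicator (chart_inv -` S) p) \<in> borel_measurable borel"
    proof -
      have "chart_inv -` S \<in> sets borel" using measurable_sets[OF measurable_chart_inv, of S] by auto
      then show ?thesis using F_meas by measurable
    qed
    have "T -` S \<inter> space M = (\<lambda>\<omega>. (X \<omega>, Y \<omega>, Z \<omega>)) -` ?A \<inter> space M"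
      using in_D by (auto simp: T_def)
    then have "emeasure M (T -` S \<inter> space M) = (\<integral>\<^sup>+p. ennreal (F p) * indicator ?A p \<partial>lborel)"
      using distributed_emeasure[OF dist, of ?A] A by simp
    also have "\<dots> = (\<integral>\<^sup>+p. (ennreal (F p) * indicator (chart_inv -` S) p) * indicator D2_coords p \<partial>lborel)"
      by (intro nn_integral_cong) (auto simp: indicator_def)
    also have "\<dots> = (\<integral>\<^sup>+q. (ennreal (F (chart q)) * indicator (chart_inv -` S) (chart q))
        * ennreal (chart_jacobian q) * indicator chart_box q \<partial>lborel)"
      by (rule nn_integral_chart) measurable
    also have "\<dots> = (\<integral>\<^sup>+q. ennreal (g q) * indicator S q \<partial>lborel)"
    proof (rule nn_integral_cong)
      fix q :: "real \<times> real \<times> real"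
      show "(ennreal (F (chart q)) * indicator (chart_inv -` S) (chart q)) * ennreal (chart_jacobian q) * indicator chart_box q
          = ennreal (g q) * indicator S q"
        using nonneg[of "chart q"] chart_jacobian_pos[of q]
        by (cases "q \<in> chart_box") (simp_all add: g_def indicator_def chart_inv_chart ennreal_mult)
    qed
    finally show ?thesis .
  qed
  define \<mu> where "\<mu> i x d = prob (R i -` {x - d<..<x + d} \<inter> space M)" for i :: nat and x d :: real
  have lim: "((\<lambda>d. \<mu> 0 u d * \<mu> 1 w d * \<mu> 2 v d / (8 * d ^ 3)) \<longlongrightarrow> g (u, w, v)) (at_right 0)"
    if "(u, w, v) \<in> chart_box" for u w v
  proof -
    let ?S = "\<lambda>d. {u - d<..<u + d} \<times> {w - d<..<w + d} \<times> {v - d<..<v + d}"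
    have "((\<lambda>d. enn2real (\<integral>\<^sup>+q. ennreal (g q) * indicator (?S d) q \<partial>lborel) / (8 * d ^ 3))
        \<longlongrightarrow> g (u, w, v)) (at_right 0)"
    proof (rule tendsto_average_of_isCont[OF g_cont[OF that] g_nonneg cube_subset_ball])
      show "\<forall>\<^sub>F d in at_right 0. emeasure lborel (?S d) = ennreal (8 * d ^ 3) \<and> 0 < 8 * d ^ 3"
        by (auto simp: eventually_at_filter emeasure_lborel_cube)
    qed (auto simp: open_Times)
    moreover have "enn2real (\<integral>\<^sup>+q. ennreal (g q) * indicator (?S d) q \<partial>lborel)
        = \<mu> 0 u d * \<mu> 1 w d * \<mu> 2 v d" for d
    proof -
      let ?A = "\<lambda>i. [{u - d<..<u + d}, {w - d<..<w + d}, {v - d<..<v + d}] ! i"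
      have "enn2real (\<integral>\<^sup>+q. ennreal (g q) * indicator (?S d) q \<partial>lborel) = prob (T -` ?S d \<inter> space M)"
        by (subst T_meas[symmetric]) (auto simp: open_Times measure_def)
      also have "T -` ?S d \<inter> space M = (\<Inter>i\<in>{0, 1, 2}. R i -` ?A i \<inter> space M)"
        by (auto simp: T_R)
      also have "prob \<dots> = (\<Prod>i\<in>{0, 1, 2}. prob (R i -` ?A i \<inter> space M))"
        using indep unfolding R_def[symmetric] by (rule indep_varsD) auto
      also have "\<dots> = \<mu> 0 u d * \<mu> 1 w d * \<mu> 2 v d" by (simp add: \<mu>_def)
      finally show ?thesis .
    qed
    ultimately show ?thesis by simp
  qed
  \<comment> \<open>Each coordinate is either kept or exchanged between the two points. By
    independence this does not change the product of the two cube probabilities, and division by the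
    volumes carries the identity over to \<open>g\<close>.\<close>
  have cross: "g (u, w, v) * g (u', w', v') = g (r, s, t) * g (r', s', t')"
    if "(u, w, v) \<in> chart_box" "(u', w', v') \<in> chart_box"
      and "(r, s, t) \<in> chart_box" "(r', s', t') \<in> chart_box"
      and "{(u, u'), (u', u)} = {(r, r'), (r', r)}" "{(w, w'), (w', w)} = {(s, s'), (s', s)}"
        "{(v, v'), (v', v)} = {(t, t'), (t', t)}"
    for u w v u' w' v' r s t r' s' t'
  proof -
    have *: "\<mu> i x d * \<mu> i x' d = \<mu> i y d * \<mu> i y' d"
      if "{(x, x'), (x', x)} = {(y, y'), (y', y)}" for i x x' y y' d
      using that by (auto simp: doubleton_eq_iff)
    have eq: "\<mu> 0 u d * \<mu> 1 w d * \<mu> 2 v d / (8 * d ^ 3) * (\<mu> 0 u' d * \<mu> 1 w' d * \<mu> 2 v' d / (8 * d ^ 3))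
      = \<mu> 0 r d * \<mu> 1 s d * \<mu> 2 t d / (8 * d ^ 3) * (\<mu> 0 r' d * \<mu> 1 s' d * \<mu> 2 t' d / (8 * d ^ 3))" for d
    proof -
      have "(\<mu> 0 u d * \<mu> 0 u' d) * (\<mu> 1 w d * \<mu> 1 w' d) * (\<mu> 2 v d * \<mu> 2 v' d)
          = (\<mu> 0 r d * \<mu> 0 r' d) * (\<mu> 1 s d * \<mu> 1 s' d) * (\<mu> 2 t d * \<mu> 2 t' d)"
        using that by (simp only: *[OF that(5)] *[OF that(6)] *[OF that(7)])
      then show ?thesis by (simp add: mult_ac)
    qed
    show ?thesis
      using tendsto_mult[OF lim[OF that(1)] lim[OF that(2)]] tendsto_mult[OF lim[OF that(3)] lim[OF that(4)]]
      unfolding eq by (rule tendsto_unique[rotated]) simp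
  qed
  define L where "L u w v = ln (g (u, w, v))" for u w v
  have L_cross: "L u w v + L u' w' v' = L r s t + L r' s' t'"
    if "(u, w, v) \<in> chart_box" "(u', w', v') \<in> chart_box"
      and "(r, s, t) \<in> chart_box" "(r', s', t') \<in> chart_box"
      and "{(u, u'), (u', u)} = {(r, r'), (r', r)}" "{(w, w'), (w', w)} = {(s, s'), (s', s)}"
        "{(v, v'), (v', v)} = {(t, t'), (t', t)}"
    for u w v u' w' v' r s t r' s' t'
    using cross[OF that] g_pos[OF that(1)] g_pos[OF that(2)] g_pos[OF that(3)] g_pos[OF that(4)]
    by (simp add: L_def ln_mult_pos[symmetric])
  \<comment> \<open>The base point is \<open>(1/2, 1/2, 0)\<close>. The logarithm of the Jacobian is
    subtracted in \<open>a\<close> and \<open>b\<close>; \<open>c\<close> needs no correction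
    because the Jacobian is free of \<open>v\<close>.\<close>
  define a where "a u = L u (1/2) 0 - ln (u * (1 - u)) / 2" for u
  define b where "b w = L (1/2) w 0 - L (1/2) (1/2) 0 - ln (1 - w) / 2" for w
  define c where "c v = L (1/2) (1/2) v - L (1/2) (1/2) 0" for v
  have main: "ln (F (chart (u, w, v))) = a u + b w + c v" if q: "(u, w, v) \<in> chart_box" for u w v
  proof -
    have bx: "0 < u" "u < 1" "0 < w" "w < 1" "-1 < v" "v < 1" using q by (auto simp: chart_box_def)
    have "L u w v + L (1/2) (1/2) 0 = L u (1/2) 0 + L (1/2) w v"
      by (rule L_cross) (use bx in \<open>auto simp: chart_box_def\<close>)
    moreover have "L (1/2) w v + L (1/2) (1/2) 0 = L (1/2) w 0 + L (1/2) (1/2) v"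
      by (rule L_cross) (use bx in \<open>auto simp: chart_box_def\<close>)
    moreover have "L u w v = ln (F (chart (u, w, v))) + (ln (u * (1 - u)) + ln (1 - w)) / 2"
    proof -
      have "L u w v = ln (F (chart (u, w, v))) + ln (sqrt (u * (1 - u) * (1 - w)))"
        using pos[OF chart_in_D2_coords[OF q]] q bx
        by (simp add: L_def g_def chart_jacobian_def ln_mult_pos)
      also have "ln (sqrt (u * (1 - u) * (1 - w))) = ln (u * (1 - u) * (1 - w)) / 2"
        using bx by (simp add: ln_sqrt)
      also have "ln (u * (1 - u) * (1 - w)) = ln (u * (1 - u)) + ln (1 - w)"
        using bx by (intro ln_mult_pos) auto
      finally show ?thesis .
    qed
    ultimately show ?thesis by (simp add: a_def b_def c_def field_simps)
  qed
  have "(c \<longlongrightarrow> 0) (at 0)"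
  proof -
    have b0: "(1/2, 1/2, 0) \<in> chart_box" by (simp add: chart_box_def)
    have "isCont (\<lambda>v::real. g (1/2, 1/2, v)) 0"
      by (rule isCont_o2[of 0 "\<lambda>v::real. (1/2, 1/2, v)" g]) (use g_cont[OF b0] in \<open>auto intro!: continuous_intros\<close>)
    then have "((\<lambda>v. g (1/2, 1/2, v)) \<longlongrightarrow> g (1/2, 1/2, 0)) (at 0)" by (simp add: isCont_def)
    then have "((\<lambda>v. ln (g (1/2, 1/2, v)) - ln (g (1/2, 1/2, 0))) \<longlongrightarrow> ln (g (1/2, 1/2, 0)) - ln (g (1/2, 1/2, 0))) (at 0)"
      using g_pos[OF b0] by (intro tendsto_intros) auto
    then show ?thesis by (simp add: c_def[abs_def] L_def)
  qed
  moreover have "c 0 = 0" by (simp add: c_def)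
  ultimately show ?thesis using that main by blast
qed

section \<open>The functional equation\<close>

lemma tendsto_at_right_0_scale:
  assumes "((\<lambda>s. f s) \<longlongrightarrow> l) (at_right (0::real))" "k > 0"
  shows "((\<lambda>s. f (k * s)) \<longlongrightarrow> l) (at_right (0::real))"
proof -
  have "filterlim (\<lambda>s. k * s) (at_right 0) (at_right 0)"
    unfolding filterlim_at using assms(2)
    by (auto intro!: tendsto_eq_intros simp: eventually_at_filter)
  from filterlim_compose[OF assms(1) this] show ?thesis .
qed

text \<open>Splitting the increment from \<open>s\<close> to \<open>r1 * r2 * s\<close> at the point
  \<open>r2 * s\<close> gives the cocycle identity
  \<open>G (r1 * r2) = r2 * G r1 + G r2\<close>.\<close>

lemma scaled_increment_limit_linear:
  fixes \<Phi> :: "real \<Rightarrow> real"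
  assumes lim: "\<And>r. r > 0 \<Longrightarrow> ((\<lambda>s. (\<Phi> (r * s) - \<Phi> s) / s) \<longlongrightarrow> G r) (at_right 0)"
    and r: "r > 0"
  shows "G r = G 2 * (r - 1)"
proof -
  have prod: "G (r1 * r2) = r2 * G r1 + G r2" if "r1 > 0" "r2 > 0" for r1 r2
  proof (rule tendsto_unique[OF _ lim])
    have "((\<lambda>s. r2 * ((\<Phi> (r1 * (r2 * s)) - \<Phi> (r2 * s)) / (r2 * s)) + (\<Phi> (r2 * s) - \<Phi> s) / s)
       \<longlongrightarrow> r2 * G r1 + G r2) (at_right 0)"
      by (intro tendsto_add tendsto_mult tendsto_const lim tendsto_at_right_0_scale[OF lim] that)
    then show "((\<lambda>s. (\<Phi> (r1 * r2 * s) - \<Phi> s) / s) \<longlongrightarrow> r2 * G r1 + G r2) (at_right 0)"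
      using that by (elim Lim_transform_eventually)
        (auto simp: eventually_at_filter field_simps)
  qed (use that in auto)
  \<comment> \<open>The cocycle identity is not symmetric in \<open>r1\<close> and \<open>r2\<close>, but its left-hand side is.\<close>
  have "r * G 2 + G r = 2 * G r + G 2"
    using prod[of 2 r] prod[of r 2] r by (simp add: mult.commute)
  then show ?thesis by (simp add: algebra_simps)
qed

text \<open>The difference quotient with step \<open>- t m\<close>, times \<open>t m / m\<close>.
  The step tends to 0 because \<open>t m / m\<close> converges, and it must be nonzero since the
  limit defining the derivative is punctured.\<close>

lemma quotient_tendsto_of_deriv:
  fixes b :: "real \<Rightarrow> real"
  assumes "(b has_real_derivative b') (at y)"
    and t: "((\<lambda>m. t m / m) \<longlongrightarrow> l) (at_right 0)"
    and pos: "\<forall>\<^sub>F m in at_right 0. t m \<noteq> 0"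
  shows "((\<lambda>m. (b y - b (y - t m)) / m) \<longlongrightarrow> b' * l) (at_right 0)"
proof -
  have "((\<lambda>m::real. t m / m * m) \<longlongrightarrow> l * 0) (at_right 0)"
    by (intro tendsto_intros t)
  then have t0: "(t \<longlongrightarrow> 0) (at_right 0)"
    by (simp, elim Lim_transform_eventually) (auto simp: eventually_at_filter)
  have "filterlim (\<lambda>m. - t m) (at 0) (at_right 0)"
    unfolding filterlim_at using pos t0 by (auto intro!: tendsto_eq_intros elim: eventually_mono)
  from filterlim_compose[OF assms(1)[unfolded DERIV_def] this]
  have "((\<lambda>m. (b (y + - t m) - b y) / - t m * (t m / m)) \<longlongrightarrow> b' * l) (at_right 0)"
    by (intro tendsto_mult t)
  then show ?thesis
  proof (rule Lim_transform_eventually)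
    show "\<forall>\<^sub>F m in at_right 0. (b (y + - t m) - b y) / - t m * (t m / m) = (b y - b (y - t m)) / m"
      using pos
    proof eventually_elim
      case (elim m)
      have "(b (y + - t m) - b y) / - t m = - (b y - b (y - t m)) / - t m" by simp
      also have "\<dots> = (b y - b (y - t m)) / t m" by (rule minus_divide_divide)
      finally show ?case using elim by simp
    qed
  qed
qed

text \<open>
  With \<open>D = det (e - x)\<close> and \<open>t = x12\<^sup>2\<close>, the parameter is \<open>m = t / D\<close>. The odds
  \<open>V1\<^sup>2 / (1 - V1\<^sup>2)\<close> and \<open>V2\<^sup>2 / (1 - V2\<^sup>2)\<close> are then \<open>m / x11\<close> and \<open>m / x22\<close>.
\<close>

definition odds_equation :: "(real \<Rightarrow> real) \<Rightarrow> (real \<Rightarrow> real) \<Rightarrow> (real \<Rightarrow> real) \<Rightarrow> (real \<Rightarrow> real) \<Rightarrow> bool" where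
  "odds_equation a b \<Phi> \<Psi> \<longleftrightarrow> (\<forall>x y m t. 0 < x \<longrightarrow> x < 1 \<longrightarrow> 0 < y \<longrightarrow> y < 1 \<longrightarrow> 0 < m \<longrightarrow>
      t = m / (1 + m) * ((1 - x) * (1 - y)) \<longrightarrow> t < x * y \<longrightarrow>
      a x + b (y - t / x) + \<Phi> (m / x) = b y + a (x - t / y) + \<Psi> (m / y))"

text \<open>Solved for \<open>\<Phi> (m / x) - \<Psi> (m / y)\<close> and divided by
  \<open>m\<close>, the equation leaves difference quotients of \<open>b\<close> at \<open>y\<close>
  and of \<open>a\<close> at \<open>x\<close>, with steps \<open>t / x\<close> and
  \<open>t / y\<close>, where \<open>t / m\<close> tends to
  \<open>(1 - x) * (1 - y)\<close>.\<close>

lemma odds_equation_limit: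
  assumes FE: "odds_equation a b \<Phi> \<Psi>"
    and a: "(a has_real_derivative a') (at x)"
    and b: "(b has_real_derivative b') (at y)"
    and x: "0 < x" "x < 1" and y: "0 < y" "y < 1"
  shows "((\<lambda>m. (\<Phi> (m / x) - \<Psi> (m / y)) / m) \<longlongrightarrow> (1 - x) * (1 - y) * (b' / x - a' / y)) (at_right 0)"
proof -
  define c where "c = (1 - x) * (1 - y)"
  have c: "c > 0" using x y by (simp add: c_def)
  define t where "t m = m / (1 + m) * c" for m :: real
  have tl: "((\<lambda>m. t m / k / m) \<longlongrightarrow> c / k) (at_right 0)" if "k > 0" for k
  proof -
    have "((\<lambda>m. c / k / (1 + m)) \<longlongrightarrow> c / k / (1 + 0)) (at_right 0)"
      by (intro tendsto_intros) auto
    then show ?thesis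
      by (simp, elim Lim_transform_eventually)
         (use that in \<open>auto simp: t_def eventually_at_right_field intro!: exI[of _ 1]\<close>)
  qed
  have nz: "\<forall>\<^sub>F m in at_right 0. t m / k \<noteq> 0" if "k > 0" for k
    using that c by (auto simp: t_def eventually_at_filter)
  have "(t \<longlongrightarrow> 0 / (1 + 0) * c) (at_right 0)"
    unfolding t_def by (intro tendsto_intros) auto
  then have ev: "\<forall>\<^sub>F m in at_right 0. t m < x * y"
    using x y by (intro order_tendstoD(2)) auto
  have pos: "\<forall>\<^sub>F m::real in at_right 0. m > 0" by (simp add: eventually_at_filter)
  have "((\<lambda>m. (b y - b (y - t m / x)) / m - (a x - a (x - t m / y)) / m)
     \<longlongrightarrow> b' * (c / x) - a' * (c / y)) (at_right 0)"
    using x y by (intro tendsto_diff quotient_tendsto_of_deriv a b tl nz)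
  also have "b' * (c / x) - a' * (c / y) = (1 - x) * (1 - y) * (b' / x - a' / y)"
    unfolding c_def[symmetric] by (simp add: right_diff_distrib mult.commute)
  finally have "((\<lambda>m. (b y - b (y - t m / x)) / m - (a x - a (x - t m / y)) / m)
     \<longlongrightarrow> (1 - x) * (1 - y) * (b' / x - a' / y)) (at_right 0)" .
  then show ?thesis
  proof (rule Lim_transform_eventually)
    show "\<forall>\<^sub>F m in at_right 0. (b y - b (y - t m / x)) / m - (a x - a (x - t m / y)) / m
        = (\<Phi> (m / x) - \<Psi> (m / y)) / m"
      using ev pos
    proof eventually_elim
      case (elim m)
      have "a x + b (y - t m / x) + \<Phi> (m / x) = b y + a (x - t m / y) + \<Psi> (m / y)"
        using FE x y elim unfolding odds_equation_def t_def c_def by blast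
      then show ?case using elim by (simp add: diff_divide_distrib[symmetric])
    qed
  qed
qed

text \<open>Subtracting the limits at \<open>(x, y)\<close> and \<open>(y, y)\<close> eliminates
  \<open>\<Psi>\<close>; the remaining limit is linear in \<open>y / x\<close>. With the diagonal
  values this gives \<open>(1 - x) * (1 - y) * (B y - A x) = k * y + \<mu> * x\<close> for
  \<open>A x = x * a' x\<close> and \<open>B y = y * b' y\<close>, and separating the variables
  determines both derivatives.\<close>

lemma odds_equation_derivs:
  assumes FE: "odds_equation a b \<Phi> \<Psi>"
    and a: "\<And>x. 0 < x \<Longrightarrow> x < 1 \<Longrightarrow> (a has_real_derivative a' x) (at x)"
    and b: "\<And>x. 0 < x \<Longrightarrow> x < 1 \<Longrightarrow> (b has_real_derivative b' x) (at x)"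
  obtains p q where "\<And>x. 0 < x \<Longrightarrow> x < 1 \<Longrightarrow> a' x = p / x - q / (1 - x)"
    and "\<And>x. 0 < x \<Longrightarrow> x < 1 \<Longrightarrow> b' x = p / x - q / (1 - x)"
proof -
  define L where "L x y = (1 - x) * (1 - y) * (b' y / x - a' x / y)" for x y
  have lim: "((\<lambda>m. (\<Phi> (m / x) - \<Psi> (m / y)) / m) \<longlongrightarrow> L x y) (at_right 0)"
    if "0 < x" "x < 1" "0 < y" "y < 1" for x y
    unfolding L_def using that by (intro odds_equation_limit[OF FE] a b)
  have diff: "((\<lambda>m. (\<Phi> (m / x) - \<Phi> (m / y)) / m) \<longlongrightarrow> L x y - L y y) (at_right 0)"
    if "0 < x" "x < 1" "0 < y" "y < 1" for x y
    using tendsto_diff[OF lim[of x y] lim[of y y]] that by (simp add: diff_divide_distrib)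
  \<comment> \<open>Any \<open>x\<close> and \<open>y\<close> in the unit interval with
    \<open>y / x = r\<close> would do; the case distinction keeps both inside it.\<close>
  define G where "G r = (let y = (if r < 1 then r / 2 else 1 / 2); x = y / r in y * (L x y - L y y))" for r
  have gen: "((\<lambda>s. (\<Phi> (y / x * s) - \<Phi> s) / s) \<longlongrightarrow> y * (L x y - L y y)) (at_right 0)"
    if "0 < x" "x < 1" "0 < y" "y < 1" for x y
  proof -
    have "((\<lambda>s. y * ((\<Phi> (y * s / x) - \<Phi> (y * s / y)) / (y * s))) \<longlongrightarrow> y * (L x y - L y y)) (at_right 0)"
      using that by (intro tendsto_mult tendsto_const tendsto_at_right_0_scale[OF diff])
    then show ?thesis using that by simp
  qed
  have G: "((\<lambda>s. (\<Phi> (r * s) - \<Phi> s) / s) \<longlongrightarrow> G r) (at_right 0)" if "r > 0" for r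
    using that gen[of "1/2" "r/2"] gen[of "1 / 2 / r" "1/2"]
    by (cases "r < 1") (auto simp: G_def Let_def)
  define k where "k = G 2"
  have H: "y * (L x y - L y y) = k * (y / x - 1)"
    if "0 < x" "x < 1" "0 < y" "y < 1" for x y
  proof -
    have "y * (L x y - L y y) = G (y / x)"
      using that by (intro tendsto_unique[OF _ gen G]) auto
    also have "\<dots> = k * (y / x - 1)"
      unfolding k_def using that by (intro scaled_increment_limit_linear[OF G]) auto
    finally show ?thesis .
  qed
  \<comment> \<open>On the diagonal \<open>x = y\<close> the limit is that of \<open>(\<Phi> s - \<Psi> s) / s\<close>, whatever \<open>y\<close> is.\<close>
  define l where "l = L (1/2) (1/2) / 2"
  have diag: "y * L y y = l" if "0 < y" "y < 1" for y
  proof -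
    have "((\<lambda>s. y * ((\<Phi> (y * s / y) - \<Psi> (y * s / y)) / (y * s))) \<longlongrightarrow> y * L y y) (at_right 0)"
      if "0 < y" "y < 1" for y
      using that by (intro tendsto_mult tendsto_const tendsto_at_right_0_scale[OF lim])
    then have "((\<lambda>s. (\<Phi> s - \<Psi> s) / s) \<longlongrightarrow> y * L y y) (at_right 0)" if "0 < y" "y < 1" for y
      using that by simp
    from tendsto_unique[OF _ this this, of y "1/2"] that show ?thesis
      by (simp add: l_def)
  qed
  define \<mu> where "\<mu> = l - k"
  define A where "A x = x * a' x" for x
  define B where "B y = y * b' y" for y
  have eq: "(1 - x) * (1 - y) * (B y - A x) = k * y + \<mu> * x"
    if "0 < x" "x < 1" "0 < y" "y < 1" for x y
  proof -
    have "y * L x y = k * (y / x - 1) + l"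
      using H[OF that] diag[of y] that by (simp add: algebra_simps)
    then have "x * (y * L x y) = x * (k * (y / x - 1) + l)" by simp
    also have "\<dots> = k * y + \<mu> * x"
      using that by (simp add: \<mu>_def field_simps)
    also have "x * (y * L x y) = (1 - x) * (1 - y) * (x * y * (b' y / x - a' x / y))"
      by (simp add: L_def mult_ac)
    also have "x * y * (b' y / x - a' x / y) = B y - A x"
      using that by (simp add: A_def B_def field_simps)
    finally show ?thesis .
  qed
  \<comment> \<open>The alternating sum of \<open>B y - A x\<close> over the four corners of a
    rectangle is 0. For the corners with entries \<open>1/2\<close> and \<open>3/4\<close> the
    right-hand sides add up to a nonzero multiple of \<open>k + \<mu>\<close>.\<close>
  have sum0: "k + \<mu> = 0"
    using eq[of "1/2" "1/2"] eq[of "1/2" "3/4"] eq[of "3/4" "1/2"] eq[of "3/4" "3/4"]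
    by (simp add: field_simps)
  have \<mu>_eq: "\<mu> = - k" using sum0 by simp
  \<comment> \<open>Since \<open>k * (y - x) / ((1 - x) * (1 - y))\<close> is the difference of
    \<open>k / (1 - y)\<close> and \<open>k / (1 - x)\<close>, the variables separate and both sides
    are one constant, \<open>\<eta>\<close> below.\<close>
  have sep: "B y - k / (1 - y) = A x - k / (1 - x)"
    if "0 < x" "x < 1" "0 < y" "y < 1" for x y
  proof -
    have "(1 - x) * (1 - y) * (B y - A x) = k * (y - x)"
      unfolding eq[OF that] \<mu>_eq by (simp add: algebra_simps)
    moreover have "k / (1 - y) - k / (1 - x) = k * (y - x) / ((1 - x) * (1 - y))"
      using that by (simp add: diff_frac_eq) (simp add: algebra_simps)
    ultimately have "B y - A x = k / (1 - y) - k / (1 - x)"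
      using that by (metis diff_gt_0_iff_gt less_irrefl mult_eq_0_iff nonzero_mult_div_cancel_left)
    then show ?thesis by simp
  qed
  define \<eta> where "\<eta> = A (1/2) - k / (1 - 1/2)"
  have Bx: "B y = \<eta> + k / (1 - y)" if "0 < y" "y < 1" for y
    using sep[of "1/2" y] that by (simp add: \<eta>_def)
  have Ax: "A x = \<eta> + k / (1 - x)" if "0 < x" "x < 1" for x
    using sep[of x "1/2"] Bx[of "1/2"] that by simp
  have alg: "(\<eta> + k / (1 - x)) / x = (\<eta> + k) / x - (- k) / (1 - x)" if "0 < x" "x < 1" for x
    using that by (simp add: field_simps)
  show ?thesis
  proof (rule that[of "\<eta> + k" "- k"])
    fix x :: real assume x: "0 < x" "x < 1"
    show "a' x = (\<eta> + k) / x - (- k) / (1 - x)"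
      using Ax[OF x] x by (simp only: alg[OF x, symmetric]) (simp add: A_def eq_divide_eq mult.commute)
    show "b' x = (\<eta> + k) / x - (- k) / (1 - x)"
      using Bx[OF x] x by (simp only: alg[OF x, symmetric]) (simp add: B_def eq_divide_eq mult.commute)
  qed
qed

lemma log_beta_antiderivative:
  fixes a :: "real \<Rightarrow> real"
  assumes "\<And>x. 0 < x \<Longrightarrow> x < 1 \<Longrightarrow> (a has_real_derivative p / x - q / (1 - x)) (at x)"
  obtains c where "\<And>x. 0 < x \<Longrightarrow> x < 1 \<Longrightarrow> a x = p * ln x + q * ln (1 - x) + c"
proof -
  have "((\<lambda>x. a x - (p * ln x + q * ln (1 - x))) has_real_derivative 0) (at x within {0<..<1})"
    if "x \<in> {0<..<1}" for x
    using that by (auto intro!: derivative_eq_intros has_field_derivative_at_within[OF assms] simp: field_simps)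
  then have "\<exists>c. \<forall>x\<in>{0<..<1}. a x - (p * ln x + q * ln (1 - x)) = c"
    by (intro has_field_derivative_zero_constant) auto
  then obtain c where "\<And>x. x \<in> {0<..<1} \<Longrightarrow> a x - (p * ln x + q * ln (1 - x)) = c" by blast
  then show ?thesis by (intro that[of c]) (auto simp: algebra_simps)
qed

text \<open>The \<open>p\<close>-terms cancel because \<open>x * (y - t / x)\<close> and
  \<open>y * (x - t / y)\<close> both equal \<open>x * y - t\<close>, and so do the constants. What
  is left says that \<open>\<Phi> + q * ln (1 + _)\<close> at \<open>m / x\<close> equals
  \<open>\<Psi> + q * ln (1 + _)\<close> at \<open>m / y\<close>; holding \<open>m / x = P\<close>
  fixed, \<open>m / y\<close> is sent to 0.\<close>

lemma odds_equation_log_solution: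
  assumes FE: "odds_equation a b \<Phi> \<Psi>"
    and a: "\<And>x. 0 < x \<Longrightarrow> x < 1 \<Longrightarrow> a x = p * ln x + q * ln (1 - x) + ca"
    and b: "\<And>x. 0 < x \<Longrightarrow> x < 1 \<Longrightarrow> b x = p * ln x + q * ln (1 - x) + cb"
    and \<Psi>: "(\<Psi> \<longlongrightarrow> 0) (at_right 0)"
    and P: "P > 0"
  shows "\<Phi> P = - q * ln (1 + P)"
proof -
  have eq: "\<Phi> P + q * ln (1 + P) = \<Psi> (x * P / (1 - x)) + q * ln (1 + x * P / (1 - x))"
    if x: "0 < x" "x < 1" for x
  proof -
    \<comment> \<open>On the line \<open>y = 1 - x\<close> every \<open>m > 0\<close> is admissible, and \<open>m / y\<close> vanishes with \<open>x\<close>.\<close>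
    define y where "y = 1 - x"
    define m where "m = x * P"
    define t where "t = m / (1 + m) * ((1 - x) * (1 - y))"
    have y: "0 < y" "y < 1" using x by (auto simp: y_def)
    have m: "m > 0" using x P by (simp add: m_def)
    have "m / (1 + m) < 1" using m by simp
    then have "m / (1 + m) * (x * y) < 1 * (x * y)"
      using x y by (intro mult_strict_right_mono) auto
    then have t: "t < x * y" unfolding t_def by (simp add: y_def mult.commute)
    have t0: "t > 0" unfolding t_def using x y m by simp
    have *: "a x + b (y - t / x) + \<Phi> (m / x) = b y + a (x - t / y) + \<Psi> (m / y)"
      using FE x y m t unfolding odds_equation_def t_def by blast
    have w: "0 < y - t / x" "0 < x - t / y" using t x y by (simp_all add: field_simps)
    have w1: "y - t / x < 1" "x - t / y < 1"
      using t0 x y divide_pos_pos[of t x] divide_pos_pos[of t y] by linarith+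
    have e1: "ln x + ln (y - t / x) = ln (x * y - t)" "ln y + ln (x - t / y) = ln (x * y - t)"
      using x y w by (simp_all add: ln_mult_pos[symmetric] right_diff_distrib mult.commute)
    have tm: "(1 + m) * t = m * ((1 - x) * (1 - y))" using m by (simp add: t_def)
    \<comment> \<open>Substitute \<open>(1 + m) * t = m * (1 - u) * (1 - v)\<close>. The identity is
      needed for \<open>(x, y)\<close> and for \<open>(y, x)\<close>, and the common factor
      \<open>1 + m\<close> then cancels between the two sides of the equation.\<close>
    have f: "1 - (v - t / u) = (1 - v) * (1 + m / u) / (1 + m)"
      if "u > 0" "(1 - x) * (1 - y) = (1 - u) * (1 - v)" for u v
    proof -
      have "(1 + m) * u * (1 - (v - t / u)) = (1 + m) * (u * (1 - v)) + (1 + m) * t"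
        using that(1) by (simp add: algebra_simps)
      also have "\<dots> = u * ((1 - v) * (1 + m / u))"
        unfolding tm that(2) using that(1) by (simp add: distrib_left) (simp add: algebra_simps)
      finally have "u * ((1 + m) * (1 - (v - t / u))) = u * ((1 - v) * (1 + m / u))"
        by (simp only: mult_ac)
      then have "(1 + m) * (1 - (v - t / u)) = (1 - v) * (1 + m / u)"
        using that(1) by simp
      then show ?thesis using m by (simp add: eq_divide_eq mult.commute)
    qed
    have f1: "1 - (y - t / x) = (1 - y) * (1 + m / x) / (1 + m)"
      and f2: "1 - (x - t / y) = (1 - x) * (1 + m / y) / (1 + m)"
      using f[of x y] f[of y x] x y by (simp_all only: mult.commute)
    have pp: "1 + m / x > 0" "1 + m / y > 0" "1 + m > 0"
      using m x y by (simp_all add: add_pos_pos)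
    have e2: "ln (1 - (y - t / x)) = ln (1 - y) + ln (1 + m / x) - ln (1 + m)"
      unfolding f1 using pp y by (simp add: ln_mult_pos ln_divide_pos)
    have e3: "ln (1 - (x - t / y)) = ln (1 - x) + ln (1 + m / y) - ln (1 + m)"
      unfolding f2 using pp x by (simp add: ln_mult_pos ln_divide_pos)
    have "p * (ln x + ln (y - t / x)) + q * (ln (1 - x) + ln (1 - (y - t / x))) + \<Phi> (m / x)
        = p * (ln y + ln (x - t / y)) + q * (ln (1 - y) + ln (1 - (x - t / y))) + \<Psi> (m / y)"
      using * a[OF x] a[OF w(2) w1(2)] b[OF y] b[OF w(1) w1(1)] by (simp add: algebra_simps)
    then have "q * ln (1 + m / x) + \<Phi> (m / x) = q * ln (1 + m / y) + \<Psi> (m / y)"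
      unfolding e1 e2 e3 by (simp add: algebra_simps)
    then show ?thesis using x by (simp add: m_def y_def)
  qed
  have Q: "filterlim (\<lambda>x. x * P / (1 - x)) (at_right 0) (at_right 0)"
  proof -
    have "((\<lambda>x. x * P / (1 - x)) \<longlongrightarrow> 0 * P / (1 - 0)) (at_right 0)"
      by (intro tendsto_intros) auto
    moreover have "\<forall>\<^sub>F x in at_right 0. x * P / (1 - x) > 0"
      using P by (auto simp: eventually_at_right_field intro!: exI[of _ 1])
    ultimately show ?thesis
      unfolding filterlim_at by (auto elim: eventually_mono)
  qed
  have "((\<lambda>x. \<Psi> (x * P / (1 - x)) + q * ln (1 + x * P / (1 - x))) \<longlongrightarrow> 0 + q * ln (1 + 0)) (at_right 0)"
    using Q by (intro tendsto_intros filterlim_compose[OF \<Psi> Q]) (auto simp: filterlim_at)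
  then have "((\<lambda>x::real. \<Phi> P + q * ln (1 + P)) \<longlongrightarrow> 0) (at_right 0)"
    by (simp, elim Lim_transform_eventually)
       (auto simp: eventually_at_right_field eq intro!: exI[of _ 1])
  then have "\<Phi> P + q * ln (1 + P) = 0" by (simp add: tendsto_const_iff)
  then show ?thesis by simp
qed

section \<open>From the two factorizations to the odds equation\<close>

lemma ln_slice_differentiable:
  fixes F :: "'a::real_normed_vector \<Rightarrow> real" and \<gamma> :: "real \<Rightarrow> 'a"
  assumes "F differentiable (at (\<gamma> x))" "F (\<gamma> x) > 0" "(\<gamma> has_derivative \<gamma>') (at x)"
  shows "\<exists>D. ((\<lambda>x. ln (F (\<gamma> x))) has_real_derivative D) (at x)"
proof -
  obtain F' where "(F has_derivative F') (at (\<gamma> x))" using assms(1) by (auto simp: differentiable_def)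
  from has_derivative_compose[OF assms(3) this] obtain D where
    "((\<lambda>x. F (\<gamma> x)) has_real_derivative D) (at x)"
    using real_differentiable_def differentiable_def by blast
  then have "((\<lambda>x. ln (F (\<gamma> x))) has_real_derivative D / F (\<gamma> x)) (at x)"
    using assms(2) by (auto intro!: derivative_eq_intros)
  then show ?thesis by blast
qed

text \<open>For \<open>x12 = \<sigma> * sqrt t\<close> with \<open>\<sigma>\<close> a sign, the
  square of \<open>V1\<close> is \<open>m / (x + m)\<close>, so its odds are
  \<open>m / x\<close>.\<close>

lemma chart_inv_odds:
  assumes x: "0 < x" "x < 1" and y: "0 < y" "y < 1" and m: "0 < m"
    and t: "t = m / (1 + m) * ((1 - x) * (1 - y))"
  shows "\<sigma> * sqrt t / sqrt ((1 - x) * (x - x * y + t)) = \<sigma> * sqrt ((m / x) / (1 + m / x))"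
proof -
  have tm: "(1 + m) * t = m * ((1 - x) * (1 - y))" using m by (simp add: t)
  have t0: "t > 0" using x y m by (simp add: t)
  have "(1 + m) * ((1 - x) * (x - x * y + t)) = (1 - x) * ((1 + m) * (x * (1 - y)) + (1 + m) * t)"
    by (simp add: algebra_simps)
  also have "\<dots> = (1 - x) * ((1 - x) * (1 - y)) * m + (1 - x) * ((1 + m) * (x * (1 - y)))"
    unfolding tm by (simp add: algebra_simps)
  also have "\<dots> = (1 - x) * (1 - y) * (x + m)" by (simp add: algebra_simps)
  finally have k: "(1 + m) * ((1 - x) * (x - x * y + t)) = (1 - x) * (1 - y) * (x + m)" .
  have "t / ((1 - x) * (x - x * y + t)) = ((1 + m) * t) / ((1 + m) * ((1 - x) * (x - x * y + t)))"
    using m by simp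
  also have "\<dots> = m / (x + m)" unfolding k tm using x y by simp
  also have "\<dots> = (m / x) / (1 + m / x)" using x m by (simp add: field_simps)
  finally have "sqrt t / sqrt ((1 - x) * (x - x * y + t)) = sqrt ((m / x) / (1 + m / x))"
    by (simp only: real_sqrt_divide[symmetric])
  then show ?thesis by (simp only: times_divide_eq_right[symmetric])
qed

text \<open>The slice \<open>x12 = 0\<close> expresses the second splitting through
  \<open>a1\<close> and \<open>b1\<close> as well. The two splittings then give an odds equation for
  each sign of \<open>x12\<close>, whose solution fixes \<open>a1\<close>, \<open>b1\<close> and
  \<open>c1\<close>.\<close>

lemma symmetric_factorization_form:
  fixes F :: "real \<times> real \<times> real \<Rightarrow> real"
  assumes diff: "\<And>p. p \<in> D2_coords \<Longrightarrow> F differentiable (at p)"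
    and pos: "\<And>p. p \<in> D2_coords \<Longrightarrow> F p > 0"
    and f1: "\<And>u w v. (u, w, v) \<in> chart_box \<Longrightarrow> ln (F (chart (u, w, v))) = a1 u + b1 w + c1 v"
    and f2: "\<And>u w v. (u, w, v) \<in> chart_box \<Longrightarrow>
      ln (case chart (u, w, v) of (y, x, z) \<Rightarrow> F (x, y, z)) = a2 u + b2 w + c2 v"
    and c: "c1 0 = 0" "c2 0 = 0" "(c2 \<longlongrightarrow> 0) (at 0)"
  obtains p q C where "\<And>u w v. (u, w, v) \<in> chart_box \<Longrightarrow> ln (F (chart (u, w, v)))
    = p * (ln u + ln w) + q * (ln (1 - u) + ln (1 - w) + ln (1 - v\<^sup>2)) + C"
proof -
  have F1: "ln (F (x, y, z)) = a1 x + b1 (y - z\<^sup>2 / x) + c1 (z / sqrt ((1 - x) * (x - x * y + z\<^sup>2)))"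
    if "(x, y, z) \<in> D2_coords" for x y z
    using chart_inv_in_chart_box[OF that] f1[of x "y - z\<^sup>2 / x" "z / sqrt ((1 - x) * (x - x * y + z\<^sup>2))"]
    by (simp add: chart_inv_def)
  have F2: "ln (F (x, y, z)) = a2 y + b2 (x - z\<^sup>2 / y) + c2 (z / sqrt ((1 - y) * (y - y * x + z\<^sup>2)))"
    if "(x, y, z) \<in> D2_coords" for x y z
  proof -
    have D: "(y, x, z) \<in> D2_coords" using that by (auto simp: D2_coords_def mult.commute)
    show ?thesis
      using chart_inv_in_chart_box[OF D] f2[of y "x - z\<^sup>2 / y" "z / sqrt ((1 - y) * (y - y * x + z\<^sup>2))"]
      by (auto simp: chart_inv_def)
  qed
  have D0: "(x, y, 0) \<in> D2_coords" if "0 < x" "x < 1" "0 < y" "y < 1" for x y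
    using that by (simp add: D2_coords_def)
  \<comment> \<open>Both \<open>c\<close>-terms vanish on this slice. It links the two splittings,
    and it is where the differentiability of \<open>a1\<close> and \<open>b1\<close> is read off
    from that of \<open>F\<close>.\<close>
  have F0: "ln (F (x, y, 0)) = a1 x + b1 y" "ln (F (x, y, 0)) = a2 y + b2 x"
    if "0 < x" "x < 1" "0 < y" "y < 1" for x y
    using F1[OF D0[OF that]] F2[OF D0[OF that]] c by simp_all
  have a: "(a1 has_real_derivative deriv a1 x) (at x)" if x: "0 < x" "x < 1" for x
  proof -
    have "((\<lambda>x. (x, 1/2 :: real, 0 :: real)) has_derivative (\<lambda>h. (h, 0, 0))) (at x :: real filter)"
      by (auto intro!: derivative_eq_intros simp: zero_prod_def)
    then have "\<exists>D. ((\<lambda>x. ln (F (x, 1/2, 0))) has_real_derivative D) (at x)"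
      using x by (intro ln_slice_differentiable[of F "\<lambda>x. (x, 1/2, 0)" x] diff pos D0) auto
    then obtain D where "((\<lambda>x. ln (F (x, 1/2, 0))) has_real_derivative D) (at x)" by blast
    then have "((\<lambda>x. ln (F (x, 1/2, 0)) - b1 (1/2)) has_real_derivative D) (at x)"
      using DERIV_diff[OF _ DERIV_const] by fastforce
    then have "(a1 has_real_derivative D) (at x)"
      by (rule has_field_derivative_transform_within_open[of _ _ _ "{0<..<1}"]) (use x F0 in auto)
    then show ?thesis using DERIV_imp_deriv by blast
  qed
  have b: "(b1 has_real_derivative deriv b1 x) (at x)" if x: "0 < x" "x < 1" for x
  proof -
    have "((\<lambda>x. (1/2 :: real, x, 0 :: real)) has_derivative (\<lambda>h. (0, h, 0))) (at x :: real filter)"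
      by (auto intro!: derivative_eq_intros simp: zero_prod_def)
    then have "\<exists>D. ((\<lambda>x. ln (F (1/2, x, 0))) has_real_derivative D) (at x)"
      using x by (intro ln_slice_differentiable[of F "\<lambda>x. (1/2, x, 0)" x] diff pos D0) auto
    then obtain D where "((\<lambda>x. ln (F (1/2, x, 0))) has_real_derivative D) (at x)" by blast
    then have "((\<lambda>x. ln (F (1/2, x, 0)) - a1 (1/2)) has_real_derivative D) (at x)"
      using DERIV_diff[OF _ DERIV_const] by fastforce
    then have "(b1 has_real_derivative D) (at x)"
      by (rule has_field_derivative_transform_within_open[of _ _ _ "{0<..<1}"]) (use x F0 in auto)
    then show ?thesis using DERIV_imp_deriv by blast
  qed
  \<comment> \<open>\<open>\<sigma>\<close> is the sign of \<open>x12\<close>. The functions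
    \<open>a1\<close> and \<open>b1\<close> do not depend on it, so the \<open>p\<close> and
    \<open>q\<close> found below for \<open>\<sigma> = 1\<close> serve both signs.\<close>
  have FE: "odds_equation a1 b1 (\<lambda>P. c1 (\<sigma> * sqrt (P / (1 + P)))) (\<lambda>P. c2 (\<sigma> * sqrt (P / (1 + P))))"
    if \<sigma>: "\<sigma>\<^sup>2 = 1" for \<sigma>
    unfolding odds_equation_def
  proof (intro allI impI)
    fix x y m t :: real
    assume x: "0 < x" "x < 1" and y: "0 < y" "y < 1" and m: "0 < m"
      and t: "t = m / (1 + m) * ((1 - x) * (1 - y))" and txy: "t < x * y"
    have t': "t = m / (1 + m) * ((1 - y) * (1 - x))" by (simp add: t mult.commute)
    have t0: "t > 0" using x y m by (simp add: t)
    have "t < 1 * ((1 - x) * (1 - y))"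
      unfolding t using x y m by (intro mult_strict_right_mono) auto
    moreover have z: "(\<sigma> * sqrt t)\<^sup>2 = t" using \<sigma> t0 by (simp add: power_mult_distrib)
    ultimately have D: "(x, y, \<sigma> * sqrt t) \<in> D2_coords"
      using x y txy by (simp add: D2_coords_def)
    have "0 < x - t / y" "x - t / y < 1"
      using txy t0 x y divide_pos_pos[of t y] by (simp add: field_simps, linarith)
    then have "a2 y + b2 (x - t / y) = a1 (x - t / y) + b1 y"
      using F0[of "x - t / y" y] y by simp
    then show "a1 x + b1 (y - t / x) + c1 (\<sigma> * sqrt (m / x / (1 + m / x)))
        = b1 y + a1 (x - t / y) + c2 (\<sigma> * sqrt (m / y / (1 + m / y)))"
      using F1[OF D] F2[OF D] unfolding z chart_inv_odds[OF x y m t] chart_inv_odds[OF y x m t']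
      by simp
  qed
  have \<Psi>: "((\<lambda>P. c2 (\<sigma> * sqrt (P / (1 + P)))) \<longlongrightarrow> 0) (at_right 0)" if \<sigma>: "\<sigma>\<^sup>2 = 1" for \<sigma>
  proof (rule filterlim_compose[OF c(3)])
    have "((\<lambda>P. \<sigma> * sqrt (P / (1 + P))) \<longlongrightarrow> \<sigma> * sqrt (0 / (1 + 0))) (at_right 0)"
      by (intro tendsto_intros) auto
    moreover have "\<forall>\<^sub>F P in at_right 0. \<sigma> * sqrt (P / (1 + P)) \<noteq> 0"
      using \<sigma> by (auto simp: eventually_at_right_field intro!: exI[of _ 1])
    ultimately show "filterlim (\<lambda>P. \<sigma> * sqrt (P / (1 + P))) (at 0) (at_right 0)"
      by (simp add: filterlim_at)
  qed
  obtain p q where a': "\<And>x. 0 < x \<Longrightarrow> x < 1 \<Longrightarrow> deriv a1 x = p / x - q / (1 - x)"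
    and b': "\<And>x. 0 < x \<Longrightarrow> x < 1 \<Longrightarrow> deriv b1 x = p / x - q / (1 - x)"
    by (rule odds_equation_derivs[OF FE[of 1] a b]) auto
  obtain ca where ca: "\<And>x. 0 < x \<Longrightarrow> x < 1 \<Longrightarrow> a1 x = p * ln x + q * ln (1 - x) + ca"
    using log_beta_antiderivative[of a1 p q] a a' by metis
  obtain cb where cb: "\<And>x. 0 < x \<Longrightarrow> x < 1 \<Longrightarrow> b1 x = p * ln x + q * ln (1 - x) + cb"
    using log_beta_antiderivative[of b1 p q] b b' by metis
  have c1: "c1 v = q * ln (1 - v\<^sup>2)" if v: "-1 < v" "v < 1" for v
  proof (cases "v = 0")
    case True
    then show ?thesis using c by simp
  next
    case False
    \<comment> \<open>The odds of \<open>v\<^sup>2\<close>, so that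
      \<open>P / (1 + P) = v\<^sup>2\<close>; the sign of \<open>v\<close> becomes
      \<open>\<sigma>\<close>.\<close>
    define P where "P = v\<^sup>2 / (1 - v\<^sup>2)"
    have v2: "v\<^sup>2 < 1" "v\<^sup>2 > 0" using v False by (auto simp: abs_square_less_1)
    have P: "P > 0" using v2 by (simp add: P_def)
    have P1: "1 + P = 1 / (1 - v\<^sup>2)" using v2 by (simp add: P_def field_simps)
    have "P / (1 + P) = v\<^sup>2" unfolding P1 using v2 by (simp add: P_def)
    then have "sgn v * sqrt (P / (1 + P)) = v" by (simp add: sgn_mult_abs)
    moreover have "(sgn v)\<^sup>2 = 1" using False by (simp add: sgn_if)
    ultimately have "c1 v = - q * ln (1 + P)"
      using odds_equation_log_solution[OF FE[of "sgn v"] ca cb \<Psi> P] by simp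
    also have "ln (1 + P) = - ln (1 - v\<^sup>2)" unfolding P1 using v2 by (simp add: ln_div)
    finally show ?thesis by simp
  qed
  show ?thesis
  proof (rule that[of p q "ca + cb"])
    fix u w v assume q: "(u, w, v) \<in> chart_box"
    then show "ln (F (chart (u, w, v)))
      = p * (ln u + ln w) + q * (ln (1 - u) + ln (1 - w) + ln (1 - v\<^sup>2)) + (ca + cb)"
      using f1[OF q] ca[of u] cb[of w] c1[of v] by (simp add: chart_box_def algebra_simps)
  qed
qed

section \<open>Beta integrals and normalization\<close>

lemma nn_integral_inverse_at_0:
  fixes r :: real
  assumes "0 < r"
  shows "(\<integral>\<^sup>+x. ennreal (1 / x) * indicator {0<..<r} x \<partial>lborel) = \<infinity>"
proof -
  have *: "ennreal R \<le> (\<integral>\<^sup>+x. ennreal (1 / x) * indicator {0<..<r} x \<partial>lborel)" if "R \<ge> 0" for R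
  proof -
    define s where "s = r / 2"
    \<comment> \<open>Chosen so that the integral of \<open>1 / x\<close> over \<open>{e..s}\<close>
      is exactly \<open>R\<close>.\<close>
    define e where "e = s * exp (- R)"
    have s: "s > 0" "s < r" using assms by (auto simp: s_def)
    have e: "0 < e" "e \<le> s" using s that by (auto simp: e_def)
    have "(\<integral>\<^sup>+x. ennreal (1 / x) * indicator {e..s} x \<partial>lborel) = ennreal (ln s - ln e)"
      using e by (intro nn_integral_FTC_Icc) (auto intro!: derivative_eq_intros)
    also have "ln s - ln e = R" using s by (simp add: e_def ln_mult_pos)
    finally have "ennreal R = (\<integral>\<^sup>+x. ennreal (1 / x) * indicator {e..s} x \<partial>lborel)" ..
    also have "\<dots> \<le> (\<integral>\<^sup>+x. ennreal (1 / x) * indicator {0<..<r} x \<partial>lborel)"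
      using e s by (intro nn_integral_mono) (auto simp: indicator_def)
    finally show ?thesis .
  qed
  show ?thesis
  proof (rule ccontr)
    assume "\<not> ?thesis"
    then obtain R where R: "R \<ge> 0" "(\<integral>\<^sup>+x. ennreal (1 / x) * indicator {0<..<r} x \<partial>lborel) = ennreal R"
      by (cases "\<integral>\<^sup>+x. ennreal (1 / x) * indicator {0<..<r} x \<partial>lborel") auto
    with *[of "R + 1"] show False by simp
  qed
qed

lemma nn_integral_Beta:
  fixes s t :: real
  assumes "s > 0" "t > 0"
  shows "(\<integral>\<^sup>+x. ennreal (x powr (s - 1) * (1 - x) powr (t - 1)) * indicator {0<..<1} x \<partial>lborel)
    = ennreal (Beta s t)"
proof -
  have "((\<lambda>x. x powr (s - 1) * (1 - x) powr (t - 1)) has_integral Beta s t) {0<..<1}"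
    using has_integral_Beta_real[OF assms] by (simp add: has_integral_Icc_iff_Ioo)
  from nn_integral_has_integral_lebesgue[OF _ this]
  show ?thesis by (simp add: mult.commute indicator_mult_ennreal)
qed

text \<open>If \<open>\<alpha> \<le> -1\<close>, the integrand dominates a positive multiple of
  \<open>1 / x\<close> near 0.\<close>

lemma nn_integral_Beta_finiteD:
  fixes \<alpha> \<beta> :: real
  assumes fin: "(\<integral>\<^sup>+x. ennreal (x powr \<alpha> * (1 - x) powr \<beta>) * indicator {0<..<1} x \<partial>lborel) < \<infinity>"
  shows "\<alpha> > -1"
proof (rule ccontr)
  assume \<alpha>: "\<not> \<alpha> > -1"
  \<comment> \<open>A lower bound for \<open>(1 - x) powr \<beta>\<close> on
    \<open>0 < x < 1/2\<close>, whatever the sign of \<open>\<beta>\<close>.\<close>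
  define k where "k = min 1 ((1/2) powr \<beta>)"
  have k: "k > 0" by (simp add: k_def)
  have low: "k / x \<le> x powr \<alpha> * (1 - x) powr \<beta>" if x: "0 < x" "x < 1/2" for x
  proof -
    have "k \<le> (1 - x) powr \<beta>"
    proof (cases "\<beta> \<ge> 0")
      case True
      have "(1/2) powr \<beta> \<le> (1 - x) powr \<beta>" using x True by (intro powr_mono2) auto
      then show ?thesis by (simp add: k_def)
    next
      case False
      have "1 = 1 powr \<beta>" by simp
      also have "1 powr \<beta> \<le> (1 - x) powr \<beta>" using x False by (intro powr_mono2') auto
      finally show ?thesis by (simp add: k_def)
    qed
    moreover have "1 / x \<le> x powr \<alpha>"
    proof -
      have "1 / x = x powr (-1)" using x by (simp add: powr_minus_divide)
      also have "\<dots> \<le> x powr \<alpha>" using x \<alpha> by (intro powr_mono') auto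
      finally show ?thesis .
    qed
    ultimately have "1 / x * k \<le> x powr \<alpha> * (1 - x) powr \<beta>"
      using x k by (intro mult_mono) auto
    then show ?thesis by simp
  qed
  have "\<infinity> = ennreal k * (\<integral>\<^sup>+x. ennreal (1 / x) * indicator {0<..<1/2} x \<partial>lborel)"
    using k by (simp add: nn_integral_inverse_at_0 ennreal_mult_top)
  also have "\<dots> = (\<integral>\<^sup>+x. ennreal k * (ennreal (1 / x) * indicator {0<..<1/2} x) \<partial>lborel)"
    by (rule nn_integral_cmult[symmetric]) measurable
  also have "\<dots> \<le> (\<integral>\<^sup>+x. ennreal (x powr \<alpha> * (1 - x) powr \<beta>) * indicator {0<..<1} x \<partial>lborel)"
    using low k by (intro nn_integral_mono)
      (auto simp: indicator_def ennreal_mult'[symmetric] intro!: ennreal_leI)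
  finally show False using fin by (simp add: top.not_eq_extremum)
qed

text \<open>Substitute \<open>v = 2 * x - 1\<close>, for which
  \<open>1 - v\<^sup>2 = 4 * x * (1 - x)\<close>.\<close>

lemma nn_integral_symmetric_Beta:
  fixes \<beta> :: real
  shows "(\<integral>\<^sup>+v. ennreal ((1 - v\<^sup>2) powr \<beta>) * indicator {-1<..<1} v \<partial>lborel)
    = ennreal (2 * 4 powr \<beta>)
      * (\<integral>\<^sup>+x. ennreal (x powr \<beta> * (1 - x) powr \<beta>) * indicator {0<..<1} x \<partial>lborel)"
proof -
  have "(\<integral>\<^sup>+v. ennreal ((1 - v\<^sup>2) powr \<beta>) * indicator {-1<..<1} v \<partial>lborel)
      = ennreal \<bar>2\<bar> * (\<integral>\<^sup>+x. ennreal ((1 - (- 1 + 2 * x)\<^sup>2) powr \<beta>) * indicator {-1<..<1} (- 1 + 2 * x :: real) \<partial>lborel)"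
    by (intro nn_integral_real_affine) auto
  also have "(\<lambda>x. ennreal ((1 - (- 1 + 2 * x)\<^sup>2) powr \<beta>) * indicator {-1<..<1} (- 1 + 2 * x :: real))
      = (\<lambda>x. ennreal (4 powr \<beta>) * (ennreal (x powr \<beta> * (1 - x) powr \<beta>) * indicator {0<..<1} x))"
  proof
    fix x :: real
    have "1 - (- 1 + 2 * x)\<^sup>2 = 4 * (x * (1 - x))" by (simp add: power2_eq_square algebra_simps)
    then show "ennreal ((1 - (- 1 + 2 * x)\<^sup>2) powr \<beta>) * indicator {-1<..<1} (- 1 + 2 * x :: real)
        = ennreal (4 powr \<beta>) * (ennreal (x powr \<beta> * (1 - x) powr \<beta>) * indicator {0<..<1} x)"
      by (auto simp: indicator_def powr_mult ennreal_mult'[symmetric])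
  qed
  also have "ennreal \<bar>2\<bar> * (\<integral>\<^sup>+x. ennreal (4 powr \<beta>) * (ennreal (x powr \<beta> * (1 - x) powr \<beta>) * indicator {0<..<1} x) \<partial>lborel)
      = ennreal (2 * 4 powr \<beta>) * (\<integral>\<^sup>+x. ennreal (x powr \<beta> * (1 - x) powr \<beta>) * indicator {0<..<1} x \<partial>lborel)"
    by (subst nn_integral_cmult) (auto simp: ennreal_mult mult.assoc)
  finally show ?thesis .
qed

text \<open>Legendre's duplication formula, carried over from the complex to the real Gamma
  function.\<close>

lemma Beta_half_right:
  fixes b :: real
  assumes "b > 0"
  shows "2 * 4 powr (b - 1) * Beta b b = Beta b (1/2)"
proof -
  let ?z = "complex_of_real b"
  have ni: "x \<notin> \<int>\<^sub>\<le>\<^sub>0" if "x > 0" for x :: real using that nonpos_Ints_nonpos by force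
  have "?z \<notin> \<int>\<^sub>\<le>\<^sub>0" "?z + 1/2 \<notin> \<int>\<^sub>\<le>\<^sub>0"
    using ni[of b] ni[of "b + 1/2"] assms of_real_in_nonpos_Ints_iff[of b, where 'a = complex]
      of_real_in_nonpos_Ints_iff[of "b + 1/2", where 'a = complex] by auto
  from Gamma_legendre_duplication[OF this]
  have "Gamma ?z * Gamma (complex_of_real (b + 1/2))
      = of_real (exp ((1 - 2 * b) * ln 2)) * of_real (sqrt pi) * Gamma (complex_of_real (2 * b))"
    by (simp add: exp_of_real[symmetric])
  then have "complex_of_real (Gamma b * Gamma (b + 1/2))
      = complex_of_real (exp ((1 - 2 * b) * ln 2) * sqrt pi * Gamma (2 * b))"
    unfolding Gamma_complex_of_real of_real_mult[symmetric] .
  then have dup: "Gamma b * Gamma (b + 1/2) = exp ((1 - 2 * b) * ln 2) * sqrt pi * Gamma (2 * b)"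
    by (simp only: of_real_eq_iff)
  have p4: "4 powr (b - 1) = exp ((b - 1) * (2 * ln 2))"
    using ln_realpow[of 2 2] by (simp add: powr_def)
  have "ln 2 + (b - 1) * (2 * ln 2) + (1 - 2 * b) * ln 2 = 0" by (simp add: algebra_simps)
  then have "exp (ln 2 + (b - 1) * (2 * ln 2) + (1 - 2 * b) * ln 2) = 1" by simp
  then have e: "2 * 4 powr (b - 1) * exp ((1 - 2 * b) * ln 2) = (1::real)"
    by (simp only: exp_add p4) simp
  have "Gamma b > 0" "Gamma (b + 1/2) > 0" "Gamma (2 * b) > 0"
    using assms by (auto intro: Gamma_real_pos)
  moreover have "2 * 4 powr (b - 1) * (Gamma b * Gamma b) * Gamma (b + 1/2)
      = (2 * 4 powr (b - 1) * exp ((1 - 2 * b) * ln 2)) * (sqrt pi * Gamma (2 * b) * Gamma b)"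
    using dup by (simp add: mult_ac)
  ultimately show ?thesis
    unfolding e Beta_def Gamma_one_half_real by (simp add: field_simps)
qed

text \<open>The left-hand side is the product of the integrals over \<open>u\<close>,
  \<open>w\<close> and \<open>v\<close>; the right-hand side is the stated normalizing constant at
  \<open>c = 1/2\<close>. In the Gamma quotients \<open>Gamma (b + 1/2)\<close> and
  \<open>Gamma (a + b)\<close> cancel.\<close>

lemma Beta_triple_identity:
  fixes a b :: real
  assumes "a > 0" "b > 0"
  shows "Beta (a + 1/2) (b + 1/2) * Beta a (b + 1/2) * Beta b (1/2)
    = Beta a b * Beta (a + b) (1/2) * Beta (a + 1/2) (b + 1/2)"
proof -
  have "Gamma (b + 1/2) > 0" "Gamma (a + b) > 0" "Gamma (a + b + 1/2) > 0"
    using assms by (auto intro: Gamma_real_pos)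
  moreover have "a + b + 1/2 = a + (b + 1/2)" "a + 1/2 + (b + 1/2) = a + b + 1" by simp_all
  ultimately show ?thesis by (simp add: Beta_def add_ac mult_ac)
qed

lemma Beta_real_pos: "a > 0 \<Longrightarrow> b > 0 \<Longrightarrow> Beta a b > (0 :: real)"
  by (simp add: Beta_def Gamma_real_pos)

lemma nn_integral_lborel_prod3_mult:
  fixes A B C :: "real \<Rightarrow> ennreal"
  assumes [measurable]: "A \<in> borel_measurable borel" "B \<in> borel_measurable borel" "C \<in> borel_measurable borel"
  shows "(\<integral>\<^sup>+(u, w, v). A u * (B w * C v) \<partial>lborel)
    = (\<integral>\<^sup>+u. A u \<partial>lborel) * ((\<integral>\<^sup>+w. B w \<partial>lborel) * (\<integral>\<^sup>+v. C v \<partial>lborel))"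
proof -
  have "(\<lambda>(u, w, v). A u * (B w * C v)) \<in> borel_measurable (borel \<Otimes>\<^sub>M (borel \<Otimes>\<^sub>M borel))"
    by measurable
  then have "(\<lambda>(u, w, v). A u * (B w * C v)) \<in> borel_measurable borel" by (simp add: borel_prod)
  then show ?thesis
    by (simp add: nn_integral_lborel_prod3 nn_integral_cmult nn_integral_multc)
qed

text \<open>In chart coordinates the total mass is a product of three one-dimensional integrals.
  Convergence of the \<open>w\<close>-integral at 0 forces \<open>a > 0\<close>, that of the
  \<open>v\<close>-integral forces \<open>b > 0\<close>, and their values give
  \<open>K\<close>.\<close>

lemma D2_normalization:
  fixes F :: "real \<times> real \<times> real \<Rightarrow> real"
  assumes F_meas: "(\<lambda>p. ennreal (F p)) \<in> borel_measurable borel"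
    and total: "(\<integral>\<^sup>+p. ennreal (F p) * indicator D2_coords p \<partial>lborel) = 1"
    and K: "K > 0"
    and F: "\<And>u w v. (u, w, v) \<in> chart_box \<Longrightarrow>
      F (chart (u, w, v)) = K * (u * w) powr (a - 1) * ((1 - u) * (1 - w) * (1 - v\<^sup>2)) powr (b - 1)"
  shows "a > 0" "b > 0" "K = 1 / (Beta a b * Beta (a + b) (1/2) * Beta (a + 1/2) (b + 1/2))"
proof -
  \<comment> \<open>The extra \<open>1/2\<close> in the exponents of \<open>A\<close> and
    \<open>B\<close> comes from the Jacobian.\<close>
  define A where "A u = ennreal (u powr (a + 1/2 - 1) * (1 - u) powr (b + 1/2 - 1)) * indicator {0<..<1} u" for u
  define B where "B w = ennreal (w powr (a - 1) * (1 - w) powr (b + 1/2 - 1)) * indicator {0<..<1} w" for w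
  define C where "C v = ennreal ((1 - v\<^sup>2) powr (b - 1)) * indicator {-1<..<1} v" for v
  have [measurable]: "A \<in> borel_measurable borel" "B \<in> borel_measurable borel" "C \<in> borel_measurable borel"
    unfolding A_def B_def C_def by measurable
  define IA where "IA = (\<integral>\<^sup>+u. A u \<partial>lborel)"
  define IB where "IB = (\<integral>\<^sup>+w. B w \<partial>lborel)"
  define IC where "IC = (\<integral>\<^sup>+v. C v \<partial>lborel)"
  have "1 = (\<integral>\<^sup>+q. ennreal (F (chart q)) * ennreal (chart_jacobian q) * indicator chart_box q \<partial>lborel)"
    unfolding total[symmetric] by (rule nn_integral_chart[OF F_meas])
  also have "\<dots> = (\<integral>\<^sup>+(u, w, v). ennreal K * A u * (B w * C v) \<partial>lborel)"
  proof (rule nn_integral_cong, clarify)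
    fix u w v :: real
    show "ennreal (F (chart (u, w, v))) * ennreal (chart_jacobian (u, w, v)) * indicator chart_box (u, w, v)
        = ennreal K * A u * (B w * C v)"
    proof (cases "(u, w, v) \<in> chart_box")
      case False
      then show ?thesis by (auto simp: chart_box_def A_def B_def C_def indicator_def)
    next
      case True
      then have bx: "0 < u" "u < 1" "0 < w" "w < 1" "-1 < v" "v < 1" by (auto simp: chart_box_def)
      then have v: "v\<^sup>2 < 1" by (simp add: abs_square_less_1)
      have half: "s powr (r + 1/2 - 1) = s powr (r - 1) * s powr (1/2)" for s r :: real
        by (simp add: powr_add[symmetric])
      have "chart_jacobian (u, w, v) = u powr (1/2) * (1 - u) powr (1/2) * (1 - w) powr (1/2)"
        using bx by (simp add: chart_jacobian_def powr_half_sqrt real_sqrt_mult)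
      moreover have "F (chart (u, w, v)) = K * (u powr (a - 1) * w powr (a - 1))
          * ((1 - u) powr (b - 1) * (1 - w) powr (b - 1) * (1 - v\<^sup>2) powr (b - 1))"
        using F[OF True] bx v by (simp add: powr_mult)
      ultimately have FJ: "F (chart (u, w, v)) * chart_jacobian (u, w, v)
          = K * (u powr (a + 1/2 - 1) * (1 - u) powr (b + 1/2 - 1))
            * ((w powr (a - 1) * (1 - w) powr (b + 1/2 - 1)) * (1 - v\<^sup>2) powr (b - 1))"
        by (simp only: half mult_ac)
      have "ennreal (F (chart (u, w, v))) * ennreal (chart_jacobian (u, w, v))
          = ennreal (F (chart (u, w, v)) * chart_jacobian (u, w, v))"
        using chart_jacobian_pos[OF True] by (simp add: ennreal_mult'' less_imp_le)
      also have "\<dots> = ennreal K * ennreal (u powr (a + 1/2 - 1) * (1 - u) powr (b + 1/2 - 1))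
          * (ennreal (w powr (a - 1) * (1 - w) powr (b + 1/2 - 1)) * ennreal ((1 - v\<^sup>2) powr (b - 1)))"
        unfolding FJ using K by (simp add: ennreal_mult less_imp_le)
      finally show ?thesis using bx True by (simp add: A_def B_def C_def)
    qed
  qed
  also have "\<dots> = (\<integral>\<^sup>+u. ennreal K * A u \<partial>lborel) * (IB * IC)"
    unfolding IB_def IC_def by (rule nn_integral_lborel_prod3_mult) measurable
  also have "(\<integral>\<^sup>+u. ennreal K * A u \<partial>lborel) = ennreal K * IA"
    unfolding IA_def by (rule nn_integral_cmult) measurable
  finally have one: "ennreal K * IA * (IB * IC) = 1" by simp
  \<comment> \<open>In \<open>ennreal\<close> a factor 0 annihilates even an infinite one, so zero
    factors have to be excluded before infinite ones.\<close>
  then have "IA \<noteq> 0" "IB \<noteq> 0" "IC \<noteq> 0" by auto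
  then have fin: "IA \<noteq> \<top>" "IB \<noteq> \<top>" "IC \<noteq> \<top>"
    using one K by (auto simp: ennreal_mult_eq_top_iff ennreal_top_mult ennreal_mult_top)
  have "(\<integral>\<^sup>+x. ennreal (x powr (a - 1) * (1 - x) powr (b + 1/2 - 1)) * indicator {0<..<1} x \<partial>lborel) < \<infinity>"
    using fin(2) by (simp add: IB_def B_def top.not_eq_extremum)
  from nn_integral_Beta_finiteD[OF this] show a: "a > 0" by simp
  have IC: "IC = ennreal (2 * 4 powr (b - 1))
      * (\<integral>\<^sup>+x. ennreal (x powr (b - 1) * (1 - x) powr (b - 1)) * indicator {0<..<1} x \<partial>lborel)"
    unfolding IC_def C_def by (rule nn_integral_symmetric_Beta)
  have "(\<integral>\<^sup>+x. ennreal (x powr (b - 1) * (1 - x) powr (b - 1)) * indicator {0<..<1} x \<partial>lborel) < \<infinity>"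
    using fin(3) unfolding IC by (auto simp: top.not_eq_extremum[symmetric] ennreal_mult_top)
  from nn_integral_Beta_finiteD[OF this] show b: "b > 0" by simp
  have "IC = ennreal (2 * 4 powr (b - 1) * Beta b b)"
    unfolding IC nn_integral_Beta[OF b b] using Beta_real_pos[OF b b] by (simp add: ennreal_mult)
  then have "IC = ennreal (Beta b (1/2))" using Beta_half_right[OF b] by simp
  moreover have "IA = ennreal (Beta (a + 1/2) (b + 1/2))" "IB = ennreal (Beta a (b + 1/2))"
    unfolding IA_def A_def IB_def B_def using a b by (intro nn_integral_Beta; simp)+
  ultimately have "ennreal (K * (Beta (a + 1/2) (b + 1/2) * Beta a (b + 1/2) * Beta b (1/2))) = 1"
    using one a b K by (simp add: ennreal_mult[symmetric] Beta_real_pos less_imp_le mult.assoc)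
  then have "K * (Beta (a + 1/2) (b + 1/2) * Beta a (b + 1/2) * Beta b (1/2)) = 1" by simp
  then have "K * (Beta a b * Beta (a + b) (1/2) * Beta (a + 1/2) (b + 1/2)) = 1"
    unfolding Beta_triple_identity[OF a b] .
  then show "K = 1 / (Beta a b * Beta (a + b) (1/2) * Beta (a + 1/2) (b + 1/2))"
    by (metis mult_zero_right nonzero_eq_divide_eq zero_neq_one)
qed

section \<open>Densities of matrices and of their coordinates\<close>

lemma distributed_coords:
  assumes X: "distributed M lborel_sym X f" and sym: "\<And>\<omega>. \<omega> \<in> space M \<Longrightarrow> X \<omega> \<in> sym_matrices"
  shows "distributed M lborel (\<lambda>\<omega>. (X \<omega> $ 1 $ 1, X \<omega> $ 2 $ 2, X \<omega> $ 1 $ 2)) (f \<circ> sym_of_coords)"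
proof -
  let ?Y = "\<lambda>x :: real ^ 2 ^ 2. (x $ 1 $ 1, x $ 2 $ 2, x $ 1 $ 2)"
  have Y: "?Y \<in> borel_measurable borel"
    by (intro borel_measurable_continuous_onI continuous_intros)
  have f [measurable]: "f \<in> borel_measurable borel"
    using distributed_borel_measurable[OF X] by (simp add: measurable_def)
  have XM: "X \<in> measurable M borel" using distributed_measurable[OF X] by (simp add: measurable_def)
  have YX: "(\<lambda>\<omega>. ?Y (X \<omega>)) \<in> measurable M lborel"
    using measurable_compose[OF XM Y] by simp
  have "distr M lborel (\<lambda>\<omega>. ?Y (X \<omega>)) = density lborel (f \<circ> sym_of_coords)"
  proof (rule measure_eqI)
    fix A assume "A \<in> sets (distr M lborel (\<lambda>\<omega>. ?Y (X \<omega>)))"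
    then have A [measurable]: "A \<in> sets borel" by simp
    have A': "?Y -` A \<in> sets borel" using measurable_sets[OF Y A] by simp
    \<comment> \<open>Reading off coordinates is a left inverse of \<open>sym_of_coords\<close>, so
      the integral over \<open>lborel_sym\<close> pulls back without a Jacobian factor.\<close>
    have ind: "indicator (?Y -` A) (sym_of_coords p) = (indicator A p :: ennreal)" for p
      by (cases p) (simp add: indicator_def)
    have "emeasure (distr M lborel (\<lambda>\<omega>. ?Y (X \<omega>))) A = emeasure M (X -` (?Y -` A) \<inter> space M)"
      using YX by (subst emeasure_distr) (auto simp: vimage_def)
    also have "\<dots> = (\<integral>\<^sup>+x. f x * indicator (?Y -` A) x \<partial>lborel_sym)"
      using A' by (intro distributed_emeasure[OF X]) simp
    also have "\<dots> = (\<integral>\<^sup>+p. f (sym_of_coords p) * indicator (?Y -` A) (sym_of_coords p) \<partial>lborel)"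
      unfolding lborel_sym_def using A' by (intro nn_integral_distr) auto
    also have "\<dots> = emeasure (density lborel (f \<circ> sym_of_coords)) A"
      using A by (subst emeasure_density) (auto simp: ind comp_def)
    finally show "emeasure (distr M lborel (\<lambda>\<omega>. ?Y (X \<omega>))) A
        = emeasure (density lborel (f \<circ> sym_of_coords)) A" .
  qed simp
  then show ?thesis using YX unfolding distributed_def by (simp add: comp_def)
qed

lemma nn_integral_lborel_swap:
  fixes K :: "real \<times> real \<times> real \<Rightarrow> ennreal"
  assumes [measurable]: "K \<in> borel_measurable borel"
  shows "(\<integral>\<^sup>+p. K p \<partial>lborel) = (\<integral>\<^sup>+(y, x, z). K (x, y, z) \<partial>lborel)"
proof -
  have [measurable]: "K \<in> borel_measurable (borel \<Otimes>\<^sub>M (borel \<Otimes>\<^sub>M borel))"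
    unfolding borel_prod by (rule assms)
  have "(\<lambda>(y, x, z). K (x, y, z)) \<in> borel_measurable (borel \<Otimes>\<^sub>M (borel \<Otimes>\<^sub>M borel))" by measurable
  then have K': "(\<lambda>(y, x, z). K (x, y, z)) \<in> borel_measurable borel" unfolding borel_prod .
  have "(\<integral>\<^sup>+x. \<integral>\<^sup>+y. \<integral>\<^sup>+z. K (x, y, z) \<partial>lborel \<partial>lborel \<partial>lborel)
      = (\<integral>\<^sup>+y. \<integral>\<^sup>+x. \<integral>\<^sup>+z. K (x, y, z) \<partial>lborel \<partial>lborel \<partial>lborel)"
    by (rule lborel_pair.Fubini') measurable
  then show ?thesis
    by (simp add: nn_integral_lborel_prod3[OF assms] nn_integral_lborel_prod3[OF K'])
qed

text \<open>Exchanging the diagonal entries preserves Lebesgue measure and turns the second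
  independence assumption into the form of the first.\<close>

lemma distributed_lborel_swap:
  fixes F :: "real \<times> real \<times> real \<Rightarrow> ennreal"
  assumes D: "distributed M lborel (\<lambda>\<omega>. (X \<omega>, Y \<omega>, Z \<omega>)) F"
  shows "distributed M lborel (\<lambda>\<omega>. (Y \<omega>, X \<omega>, Z \<omega>)) (\<lambda>(y, x, z). F (x, y, z))"
proof -
  let ?s = "\<lambda>(x, y, z). (y, x, z) :: real \<times> real \<times> real"
  have s: "?s \<in> borel_measurable borel"
    unfolding case_prod_beta by (intro borel_measurable_continuous_onI continuous_intros)
  have F: "F \<in> borel_measurable borel" using distributed_borel_measurable[OF D] by simp
  have Fs: "(\<lambda>(y, x, z). F (x, y, z)) \<in> borel_measurable borel"
    using measurable_compose[OF s F] by (simp add: case_prod_beta)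
  have sM: "(\<lambda>\<omega>. (Y \<omega>, X \<omega>, Z \<omega>)) \<in> measurable M lborel"
    using measurable_compose[OF _ s, of "\<lambda>\<omega>. (X \<omega>, Y \<omega>, Z \<omega>)" M] distributed_measurable[OF D] by simp
  have "distr M lborel (\<lambda>\<omega>. (Y \<omega>, X \<omega>, Z \<omega>)) = density lborel (\<lambda>(y, x, z). F (x, y, z))"
  proof (rule measure_eqI)
    fix A assume "A \<in> sets (distr M lborel (\<lambda>\<omega>. (Y \<omega>, X \<omega>, Z \<omega>)))"
    then have A: "A \<in> sets borel" by simp
    have A': "?s -` A \<in> sets borel" using measurable_sets[OF s A] by simp
    have "emeasure (distr M lborel (\<lambda>\<omega>. (Y \<omega>, X \<omega>, Z \<omega>))) A
        = emeasure M ((\<lambda>\<omega>. (X \<omega>, Y \<omega>, Z \<omega>)) -` (?s -` A) \<inter> space M)"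
      using sM A by (subst emeasure_distr) (auto simp: vimage_def)
    also have "\<dots> = (\<integral>\<^sup>+p. F p * indicator (?s -` A) p \<partial>lborel)"
      using A' by (intro distributed_emeasure[OF D]) simp
    also have "\<dots> = (\<integral>\<^sup>+(y, x, z). F (x, y, z) * indicator (?s -` A) (x, y, z) \<partial>lborel)"
      using F A' by (intro nn_integral_lborel_swap borel_measurable_times_ennreal borel_measurable_indicator)
    also have "\<dots> = emeasure (density lborel (\<lambda>(y, x, z). F (x, y, z))) A"
      using A Fs by (subst emeasure_density) (auto simp: indicator_def case_prod_beta intro!: nn_integral_cong)
    finally show "emeasure (distr M lborel (\<lambda>\<omega>. (Y \<omega>, X \<omega>, Z \<omega>))) A
        = emeasure (density lborel (\<lambda>(y, x, z). F (x, y, z))) A" .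
  qed simp
  then show ?thesis using sM Fs unfolding distributed_def by simp
qed

section \<open>The density formula and the law of \<open>X\<close>\<close>

lemma det_sym_of_coords: "det (sym_of_coords (x, y, z)) = x * y - z\<^sup>2"
  by (simp add: det_2 power2_eq_square)

lemma rpow_pos: "t > 0 \<Longrightarrow> rpow t s = t powr s"
  by (simp add: rpow_def)

text \<open>At \<open>c = 1/2\<close> the exponent of the off-diagonal entry is 0, and
  \<open>rpow\<close> makes that factor 1 also where \<open>v = 0\<close>.\<close>

lemma D2_density_half_chart:
  assumes "(u, w, v) \<in> chart_box"
  shows "D2_density a b (1/2) (sym_of_coords (chart (u, w, v)))
    = (u * w) powr (a - 1) * ((1 - u) * (1 - w) * (1 - v\<^sup>2)) powr (b - 1)
      / (Beta a b * Beta (a + b) (1/2) * Beta (a + 1/2) (b + 1/2))"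
proof -
  have bx: "0 < u" "u < 1" "0 < w" "w < 1" "v\<^sup>2 < 1"
    using assms by (auto simp: chart_box_def abs_square_less_1)
  define x y z where "x = u" and "y = w + v\<^sup>2 * (1 - u) * (1 - w)" and "z = v * sqrt (u * (1 - u) * (1 - w))"
  have ch: "chart (u, w, v) = (x, y, z)" by (simp add: chart_def x_def y_def z_def)
  have z2: "z\<^sup>2 = v\<^sup>2 * (u * (1 - u) * (1 - w))" using bx by (simp add: z_def power_mult_distrib)
  have d1: "x * y - z\<^sup>2 = u * w" unfolding z2 by (simp add: x_def y_def algebra_simps)
  have d2: "(1 - x) * (1 - y) - z\<^sup>2 = (1 - u) * (1 - w) * (1 - v\<^sup>2)"
    unfolding z2 by (simp add: x_def y_def power2_eq_square algebra_simps)
  have "sym_of_coords (x, y, z) \<in> D2"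
    using chart_in_D2_coords[OF assms] by (simp add: sym_of_coords_in_D2_iff ch)
  then show ?thesis
    using bx by (simp add: D2_density_def ch one_minus_sym_of_coords det_sym_of_coords d1 d2 rpow_pos)
      (simp add: rpow_def)
qed

text \<open>\<open>D2\<close> is not open among all matrices, but it is the intersection of the
  closed subspace of symmetric matrices with the preimage of the open set
  \<open>D2_coords\<close>.\<close>

lemma measurable_D2 [measurable]: "D2 \<in> sets borel"
proof -
  let ?Y = "\<lambda>x :: real ^ 2 ^ 2. (x $ 1 $ 1, x $ 2 $ 2, x $ 1 $ 2)"
  have "x \<in> D2 \<longleftrightarrow> x \<in> sym_matrices \<and> ?Y x \<in> D2_coords" for x
  proof (cases "x \<in> sym_matrices")
    case True
    then obtain p where "x = sym_of_coords p" by (auto simp: range_sym_of_coords[symmetric])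
    then show ?thesis using True by (cases p) (simp add: sym_of_coords_in_D2_iff)
  qed (auto simp: D2_def pos_def_matrices_def)
  then have D2_eq: "D2 = {x. x $ 2 $ 1 = x $ 1 $ 2} \<inter> ?Y -` D2_coords"
    by (auto simp: sym_matrices_iff)
  show ?thesis
    unfolding D2_eq
    by (intro sets.Int borel_closed borel_open closed_Collect_eq open_vimage open_D2_coords continuous_intros)
qed

theorem theorem4:
  fixes M :: "'w measure"
    and X :: "'w \<Rightarrow> real ^ 2 ^ 2"
    and f :: "real ^ 2 ^ 2 \<Rightarrow> real"
  assumes prob: "prob_space M"
    and X_in_D2: "\<And>\<omega>. \<omega> \<in> space M \<Longrightarrow> X \<omega> \<in> D2"
    and f_nonneg: "\<And>x. f x \<ge> 0"
    and density: "distributed M lborel_sym X (\<lambda>x. ennreal (f x))"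
    and f_C1: "continuously_differentiable_on (f \<circ> sym_of_coords) (sym_of_coords -` D2)"
    and f_pos: "\<And>x. x \<in> D2 \<Longrightarrow> f x > 0"
    and indep1: "prob_space.indep_vars M (\<lambda>_. borel)
      (\<lambda>i \<omega>. let x11 = X \<omega> $ 1 $ 1; x12 = X \<omega> $ 1 $ 2; x22 = X \<omega> $ 2 $ 2 in
         [x11,
          x22 - x12\<^sup>2 / x11,
          x12 / sqrt ((1 - x11) * (x11 - x11 * x22 + x12\<^sup>2))] ! i)
      {0, 1, 2 :: nat}"
    and indep2: "prob_space.indep_vars M (\<lambda>_. borel)
      (\<lambda>i \<omega>. let x11 = X \<omega> $ 1 $ 1; x12 = X \<omega> $ 1 $ 2; x22 = X \<omega> $ 2 $ 2 in
         [x22,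
          x11 - x12\<^sup>2 / x22,
          x12 / sqrt ((1 - x22) * (x22 - x11 * x22 + x12\<^sup>2))] ! i)
      {0, 1, 2 :: nat}"
  shows "\<exists>a b c :: real. a > 0 \<and> b > 0 \<and> c > 0 \<and>
    distributed M lborel_sym X (\<lambda>x. ennreal (D2_density a b c x)) \<and>
    (\<forall>x\<in>D2. f x = D2_density a b c x)"
proof -
  interpret prob_space M by fact
  define F where "F = f \<circ> sym_of_coords"
  define F' where "F' = (\<lambda>(y, x, z). F (x, y, z))"
  have F_pos: "F p > 0" if "p \<in> D2_coords" for p
    using that f_pos sym_of_coords_in_D2_iff by (simp add: F_def)
  have F_nonneg: "F p \<ge> 0" for p by (simp add: F_def f_nonneg)
  have F_diff: "F differentiable (at p)" if "p \<in> D2_coords" for p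
    using f_C1 that sym_of_coords_in_D2_iff
    unfolding continuously_differentiable_on_def F_def differentiable_def by blast
  have F_cont: "isCont F p" if "p \<in> D2_coords" for p
    using F_diff[OF that] by (rule differentiable_imp_continuous_within)
  have swap: "(y, x, z) \<in> D2_coords \<longleftrightarrow> (x, y, z) \<in> D2_coords" for x y z
    by (auto simp: D2_coords_def mult.commute)
  have F'_cont: "isCont F' p" if "p \<in> D2_coords" for p
  proof -
    have "isCont F (fst (snd p), fst p, snd (snd p))"
      using that by (intro F_cont) (simp add: swap)
    then have "isCont (\<lambda>p. F (fst (snd p), fst p, snd (snd p))) p"
      by (intro isCont_o2[of p "\<lambda>p. (fst (snd p), fst p, snd (snd p))" F] continuous_intros)
    then show ?thesis by (simp add: F'_def case_prod_beta')
  qed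
  have sym: "X \<omega> \<in> sym_matrices" if "\<omega> \<in> space M" for \<omega>
    using X_in_D2[OF that] by (simp add: D2_def pos_def_matrices_def)
  have Y: "distributed M lborel (\<lambda>\<omega>. (X \<omega> $ 1 $ 1, X \<omega> $ 2 $ 2, X \<omega> $ 1 $ 2)) (\<lambda>p. ennreal (F p))"
    using distributed_coords[OF density sym] by (simp add: F_def comp_def)
  have in_D: "(X \<omega> $ 1 $ 1, X \<omega> $ 2 $ 2, X \<omega> $ 1 $ 2) \<in> D2_coords" if "\<omega> \<in> space M" for \<omega>
    using X_in_D2[OF that] by (auto elim!: D2E)
  have F_meas: "(\<lambda>p. ennreal (F p)) \<in> borel_measurable borel"
    using distributed_borel_measurable[OF Y] by simp
  have total: "(\<integral>\<^sup>+p. ennreal (F p) * indicator D2_coords p \<partial>lborel) = 1"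
  proof -
    have "(\<lambda>\<omega>. (X \<omega> $ 1 $ 1, X \<omega> $ 2 $ 2, X \<omega> $ 1 $ 2)) -` D2_coords \<inter> space M = space M"
      using in_D by auto
    then show ?thesis
      using distributed_emeasure[OF Y, of D2_coords] emeasure_space_1 measurable_D2_coords by simp
  qed
  have Y': "distributed M lborel (\<lambda>\<omega>. (X \<omega> $ 2 $ 2, X \<omega> $ 1 $ 1, X \<omega> $ 1 $ 2)) (\<lambda>p. ennreal (F' p))"
    using distributed_lborel_swap[OF Y] by (simp add: F'_def case_prod_beta')
  obtain a1 b1 c1 where 1: "c1 0 = 0" "(c1 \<longlongrightarrow> 0) (at 0)"
    "\<And>u w v. (u, w, v) \<in> chart_box \<Longrightarrow> ln (F (chart (u, w, v))) = a1 u + b1 w + c1 v"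
    by (rule chart_factorization[OF prob Y in_D F_nonneg F_pos F_cont])
       (use indep1 in \<open>simp_all add: Let_def\<close>)
  obtain a2 b2 c2 where 2: "c2 0 = 0" "(c2 \<longlongrightarrow> 0) (at 0)"
    "\<And>u w v. (u, w, v) \<in> chart_box \<Longrightarrow> ln (F' (chart (u, w, v))) = a2 u + b2 w + c2 v"
  proof (rule chart_factorization[OF prob Y' _ _ _ F'_cont])
    show "(X \<omega> $ 2 $ 2, X \<omega> $ 1 $ 1, X \<omega> $ 1 $ 2) \<in> D2_coords" if "\<omega> \<in> space M" for \<omega>
      using in_D[OF that] by (simp add: swap)
    show "F' p \<ge> 0" for p by (cases p) (simp add: F'_def F_nonneg)
    show "F' p > 0" if "p \<in> D2_coords" for p
      using that by (cases p) (simp add: F'_def F_pos swap)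
    show "indep_vars (\<lambda>_. borel)
      (\<lambda>i \<omega>. [X \<omega> $ 2 $ 2, X \<omega> $ 1 $ 1 - (X \<omega> $ 1 $ 2)\<^sup>2 / X \<omega> $ 2 $ 2,
        X \<omega> $ 1 $ 2 / sqrt ((1 - X \<omega> $ 2 $ 2) * (X \<omega> $ 2 $ 2 - X \<omega> $ 2 $ 2 * X \<omega> $ 1 $ 1 + (X \<omega> $ 1 $ 2)\<^sup>2))] ! i)
      {0, 1, 2 :: nat}"
      using indep2 by (simp add: Let_def mult.commute[of "X _ $ 1 $ 1" "X _ $ 2 $ 2"])
    fix a b c :: "real \<Rightarrow> real"
    assume A: "c 0 = 0" "(c \<longlongrightarrow> 0) (at 0)"
      "\<And>u w v. (u, w, v) \<in> chart_box \<Longrightarrow> ln (F' (chart (u, w, v))) = a u + b w + c v"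
    show thesis by (rule that[OF A])
  qed
  obtain p q C where pq: "\<And>u w v. (u, w, v) \<in> chart_box \<Longrightarrow> ln (F (chart (u, w, v)))
      = p * (ln u + ln w) + q * (ln (1 - u) + ln (1 - w) + ln (1 - v\<^sup>2)) + C"
    by (rule symmetric_factorization_form[OF F_diff F_pos 1(3) 2(3)[unfolded F'_def] 1(1) 2(1,2)]) auto
  define a b where "a = p + 1" and "b = q + 1"
  have F_form: "F (chart (u, w, v))
      = exp C * (u * w) powr (a - 1) * ((1 - u) * (1 - w) * (1 - v\<^sup>2)) powr (b - 1)"
    if q: "(u, w, v) \<in> chart_box" for u w v
  proof -
    have bx: "0 < u" "u < 1" "0 < w" "w < 1" "v\<^sup>2 < 1"
      using q by (auto simp: chart_box_def abs_square_less_1)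
    have "F (chart (u, w, v)) = exp (ln (F (chart (u, w, v))))"
      using F_pos[OF chart_in_D2_coords[OF q]] by simp
    also have "\<dots> = exp C * exp (p * ln (u * w)) * exp (q * ln ((1 - u) * (1 - w) * (1 - v\<^sup>2)))"
      unfolding pq[OF q] using bx by (simp add: exp_add[symmetric] ln_mult_pos add_ac)
    finally show ?thesis using bx by (simp add: powr_def a_def b_def)
  qed
  note norm = D2_normalization[OF F_meas total exp_gt_zero F_form]
  have eq: "f x = D2_density a b (1/2) x" if x: "x \<in> D2" for x
  proof -
    obtain p where p: "p \<in> D2_coords" "x = sym_of_coords p" using x by (rule D2E)
    obtain u w v where uwv: "chart_inv p = (u, w, v)" by (cases "chart_inv p")
    have q: "(u, w, v) \<in> chart_box" "chart (u, w, v) = p"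
      using chart_inv_in_chart_box[OF p(1)] by (simp_all add: uwv)
    show ?thesis
      using F_form[OF q(1)] D2_density_half_chart[OF q(1), of a b] norm(3) q(2) p(2)
      by (simp add: F_def)
  qed
  have f_meas [measurable]: "(\<lambda>x. ennreal (f x)) \<in> borel_measurable borel"
    using distributed_borel_measurable[OF density] by (simp add: measurable_def)
  have D2_zero: "D2_density a b (1/2) x = 0" if "x \<notin> D2" for x
    using that by (simp add: D2_density_def)
  have dens: "ennreal (D2_density a b (1/2) x) = ennreal (f x) * indicator D2 x" for x
    using eq[of x] D2_zero[of x] by (auto simp: indicator_def)
  \<comment> \<open>Outside \<open>D2\<close> the function \<open>f\<close> is only known to be
    nonnegative. Its integral there is the probability that \<open>X\<close> leaves
    \<open>D2\<close>, which is 0, so it vanishes there almost everywhere.\<close>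
  have "AE x in lborel_sym. ennreal (f x) = ennreal (D2_density a b (1/2) x)"
  proof -
    have "(\<integral>\<^sup>+x. ennreal (f x) * indicator (- D2) x \<partial>lborel_sym) = emeasure M (X -` (- D2) \<inter> space M)"
      by (rule distributed_emeasure[OF density, symmetric]) simp
    also have "X -` (- D2) \<inter> space M = {}" using X_in_D2 by auto
    finally have "(\<integral>\<^sup>+x. ennreal (f x) * indicator (- D2) x \<partial>lborel_sym) = 0" by simp
    moreover have "(\<lambda>x. ennreal (f x) * indicator (- D2) x) \<in> borel_measurable lborel_sym"
      by measurable
    ultimately have "AE x in lborel_sym. ennreal (f x) * indicator (- D2) x = 0"
      by (simp only: nn_integral_0_iff_AE)
    then show ?thesis
      by eventually_elim (auto simp: dens indicator_def)
  qed
  then have "density lborel_sym (\<lambda>x. ennreal (f x)) = density lborel_sym (\<lambda>x. ennreal (D2_density a b (1/2) x))"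
    by (intro density_cong) (simp_all add: dens)
  then have "distributed M lborel_sym X (\<lambda>x. ennreal (D2_density a b (1/2) x))"
    using density by (simp add: distributed_def dens)
  with norm(1,2) eq show ?thesis by (intro exI[of _ a] exI[of _ b] exI[of _ "1/2"]) auto
qed

end
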